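(* Let $H$ be a nonzero complex Hilbert space. There are infinitely many Molnár means on $B(H)^{+}$.
   Context: $B(H)^{+}$ is the set of positive semidefinite bounded linear operators on the complex Hilbert space $H$, ordered by the Loewner order; $B(H)^{++}$ is the set of invertible elements of $B(H)^{+}$; $I$ is the identity. $A_n\downarrow A$ means $A_1\ge A_2\ge\cdots$ and $A_n\to A$ strongly. A connection is a binary operation $\sigma$ on $B(H)^{+}$ such that: (I) $A\le C$, $B\le D$ imply $A\sigma B\le C\sigma D$; (II) $C(A\sigma B)C\le (CAC)\sigma(CBC)$; (III) $A_n\downarrow A$, $B_n\downarrow B$ imply $A_n\sigma B_n\downarrow A\sigma B$. A connection is a (Kubo-Ando) mean if $I\sigma I=I$, and it is symmetric if $A\sigma B=B\sigma A$ for all $A,B\in B(H)^{+}$. $OM_+$ denotes the class of all analytic functions $f:\mathbb{C}\setminus(-\infty,0]\to\mathbb{C}$ with $f(x)\ge 0$ for real $x>0$ and $\operatorname{Im} f(z)\ge 0$ whenever $\operatorname{Im} z>0$; by Loewner's theorem, restriction to $(0,\infty)$ identifies $OM_+$ with the positive operator monotone functions $(0,\infty)\to[0,\infty)$. Each $f\in OM_+$ gives rise to a connection $\sigma_f$ by $A\sigma_f B=A^{1/2}f(A^{-1/2}BA^{-1/2})A^{1/2}$ for $A,B\in B(H)^{++}$, extended uniquely to $B(H)^{+}$ by (III). A connection $\sigma$ has representing function $f$ if $\sigma=\sigma_f$; then $f(x)I=I\sigma(xI)$ for $x>0$. A Molnár mean is a symmetric Kubo-Ando mean $\sigma=\sigma_f$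 whose representing function $f$ has the property: there is a positive scalar $c\ne 1$ such that $f(c^2x)=cf(x)$ for all $x>0$. *)

theory Defs
  imports "HOL-Analysis.Analysis" "HOL-Computational_Algebra.Polynomial"
begin

section \<open>Complex Hilbert spaces\<close>

text \<open>
  The inner product is linear in its second argument. Positive definiteness and the
  agreement of the norm of the class \<^class>\<open>banach\<close> with the norm of the inner product
  are both contained in the last axiom, completeness in \<^class>\<open>banach\<close>.
\<close>

class complex_hilbert_space = banach +
  fixes scaleC :: "complex \<Rightarrow> 'a \<Rightarrow> 'a"  (infixr \<open>*\<^sub>C\<close> 75)
    and cinner :: "'a \<Rightarrow> 'a \<Rightarrow> complex"
  assumes scaleC_add_right: "a *\<^sub>C (x + y) = a *\<^sub>C x + a *\<^sub>C y"
    and scaleC_add_left: "(a + b) *\<^sub>C x = a *\<^sub>C x + b *\<^sub>C x"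
    and scaleC_scaleC: "a *\<^sub>C b *\<^sub>C x = (a * b) *\<^sub>C x"
    and scaleC_of_real: "complex_of_real r *\<^sub>C x = r *\<^sub>R x"
    and cinner_commute: "cinner x y = cnj (cinner y x)"
    and cinner_add_right: "cinner x (y + z) = cinner x y + cinner x z"
    and cinner_scaleC_right: "cinner x (a *\<^sub>C y) = a * cinner x y"
    and cinner_self: "cinner x x = complex_of_real ((norm x)\<^sup>2)"

lemma norm_scaleC: "norm (a *\<^sub>C x) = cmod a * norm (x :: 'h::complex_hilbert_space)"
proof -
  have "cinner (a *\<^sub>C x) (a *\<^sub>C x) = a * cnj (cinner x (a *\<^sub>C x))"
    by (metis cinner_scaleC_right cinner_commute)
  also have "\<dots> = (a * cnj a) * cnj (cinner x x)"
    by (simp add: cinner_scaleC_right)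
  also have "\<dots> = complex_of_real ((cmod a * norm x)\<^sup>2)"
    by (simp add: cinner_self power_mult_distrib flip: complex_norm_square)
  finally have "(norm (a *\<^sub>C x))\<^sup>2 = (cmod a * norm x)\<^sup>2"
    unfolding cinner_self of_real_eq_iff .
  then show ?thesis
    by (simp add: power2_eq_iff_nonneg)
qed


section \<open>Operators\<close>

text \<open>
  The library type of bounded operators only knows real linearity, so \<open>B(H)\<close> is cut out of it.
\<close>

definition bounded_ops :: "('h::complex_hilbert_space \<Rightarrow>\<^sub>L 'h) set" where
  "bounded_ops = {A :: 'h \<Rightarrow>\<^sub>L 'h. \<forall>a x. A (a *\<^sub>C x) = a *\<^sub>C A x}"

definition pos_ops :: "('h::complex_hilbert_space \<Rightarrow>\<^sub>L 'h) set" where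
  "pos_ops = {A \<in> bounded_ops. \<forall>x. cinner x (A x) \<in> \<real>\<^sub>\<ge>\<^sub>0}"

definition loewner_le ::
    "('h::complex_hilbert_space \<Rightarrow>\<^sub>L 'h) \<Rightarrow> ('h \<Rightarrow>\<^sub>L 'h) \<Rightarrow> bool"  (infix \<open>\<preceq>\<close> 50) where
  "A \<preceq> B \<longleftrightarrow> B - A \<in> pos_ops"

definition inverse_of :: "('h::complex_hilbert_space \<Rightarrow>\<^sub>L 'h) \<Rightarrow> ('h \<Rightarrow>\<^sub>L 'h) \<Rightarrow> bool" where
  "inverse_of A B \<longleftrightarrow> B \<in> bounded_ops \<and> A o\<^sub>L B = id_blinfun \<and> B o\<^sub>L A = id_blinfun"

definition op_invertible :: "('h::complex_hilbert_space \<Rightarrow>\<^sub>L 'h) \<Rightarrow> bool" where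
  "op_invertible A \<longleftrightarrow> (\<exists>B. inverse_of A B)"

definition op_inv :: "('h::complex_hilbert_space \<Rightarrow>\<^sub>L 'h) \<Rightarrow> ('h \<Rightarrow>\<^sub>L 'h)" where
  "op_inv A = (THE B. inverse_of A B)"

definition pos_inv_ops :: "('h::complex_hilbert_space \<Rightarrow>\<^sub>L 'h) set" where
  "pos_inv_ops = {A \<in> pos_ops. op_invertible A}"

definition op_sqrt :: "('h::complex_hilbert_space \<Rightarrow>\<^sub>L 'h) \<Rightarrow> ('h \<Rightarrow>\<^sub>L 'h)" where
  "op_sqrt A = (THE S. S \<in> pos_ops \<and> S o\<^sub>L S = A)"

definition decreases_to ::
    "(nat \<Rightarrow> 'h::complex_hilbert_space \<Rightarrow>\<^sub>L 'h) \<Rightarrow> ('h \<Rightarrow>\<^sub>L 'h) \<Rightarrow> bool"  (infix \<open>\<down>\<close> 50) where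
  "X \<down> A \<longleftrightarrow> (\<forall>n. X (Suc n) \<preceq> X n) \<and> limitin strong_operator_topology X A sequentially"


section \<open>Continuous functional calculus\<close>

lift_definition op_scaleC ::
    "complex \<Rightarrow> ('h::complex_hilbert_space \<Rightarrow>\<^sub>L 'h) \<Rightarrow> ('h \<Rightarrow>\<^sub>L 'h)" is
  "\<lambda>a A x. a *\<^sub>C A x"
proof -
  fix a and A :: "'h \<Rightarrow> 'h"
  assume A: "bounded_linear A"
  have "bounded_linear (\<lambda>x::'h. a *\<^sub>C x)"
  proof (rule bounded_linear_intro)
    fix r and x :: 'h
    show "a *\<^sub>C r *\<^sub>R x = r *\<^sub>R a *\<^sub>C x"
      by (metis scaleC_of_real scaleC_scaleC mult.commute)
    show "norm (a *\<^sub>C x) \<le> norm x * cmod a"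
      by (simp add: norm_scaleC)
  qed (rule scaleC_add_right)
  from bounded_linear_compose[OF this A] show "bounded_linear (\<lambda>x. a *\<^sub>C A x)" .
qed

definition op_spectrum :: "('h::complex_hilbert_space \<Rightarrow>\<^sub>L 'h) \<Rightarrow> complex set" where
  "op_spectrum A = {z. \<not> op_invertible (A - op_scaleC z id_blinfun)}"

definition op_power :: "('h::complex_hilbert_space \<Rightarrow>\<^sub>L 'h) \<Rightarrow> nat \<Rightarrow> ('h \<Rightarrow>\<^sub>L 'h)" where
  "op_power A n = ((\<lambda>B. A o\<^sub>L B) ^^ n) id_blinfun"

definition op_poly :: "complex poly \<Rightarrow> ('h::complex_hilbert_space \<Rightarrow>\<^sub>L 'h) \<Rightarrow> ('h \<Rightarrow>\<^sub>L 'h)" where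
  "op_poly p A = (\<Sum>i\<le>degree p. op_scaleC (coeff p i) (op_power A i))"

text \<open>
  For self-adjoint \<open>A\<close> and \<open>f\<close> continuous on the spectrum, \<open>f(A)\<close> is the norm limit of
  \<open>p\<^sub>n(A)\<close> for any polynomials \<open>p\<^sub>n\<close> that converge to \<open>f\<close> uniformly on the spectrum: such
  polynomials exist by Weierstrass, and \<open>\<parallel>p(A)\<parallel>\<close> is the maximum of \<open>|p|\<close> on the spectrum,
  which makes the limit exist and independent of the choice.
\<close>

definition fun_calc ::
    "(complex \<Rightarrow> complex) \<Rightarrow> ('h::complex_hilbert_space \<Rightarrow>\<^sub>L 'h) \<Rightarrow> ('h \<Rightarrow>\<^sub>L 'h)" where
  "fun_calc f A = (THE S. \<exists>p. uniform_limit (op_spectrum A) (\<lambda>n. poly (p n)) f sequentially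
                              \<and> (\<lambda>n. op_poly (p n) A) \<longlonglongrightarrow> S)"


section \<open>Connections and means\<close>

text \<open>
  A binary operation on \<open>B(H)\<^sup>+\<close> is a curried function in the extensional function space over
  \<^const>\<open>pos_ops\<close>, so that two operations are equal as soon as they agree on \<open>B(H)\<^sup>+\<close>.
\<close>

type_synonym 'h binop = "('h \<Rightarrow>\<^sub>L 'h) \<Rightarrow> ('h \<Rightarrow>\<^sub>L 'h) \<Rightarrow> ('h \<Rightarrow>\<^sub>L 'h)"

definition connection :: "'h::complex_hilbert_space binop \<Rightarrow> bool" where
  "connection \<sigma> \<longleftrightarrow>
     \<sigma> \<in> pos_ops \<rightarrow>\<^sub>E pos_ops \<rightarrow>\<^sub>E pos_ops \<and>
     (\<forall>A\<in>pos_ops. \<forall>B\<in>pos_ops. \<forall>C\<in>pos_ops. \<forall>D\<in>pos_ops.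
        A \<preceq> C \<longrightarrow> B \<preceq> D \<longrightarrow> \<sigma> A B \<preceq> \<sigma> C D) \<and>
     (\<forall>A\<in>pos_ops. \<forall>B\<in>pos_ops. \<forall>C\<in>pos_ops.
        C o\<^sub>L \<sigma> A B o\<^sub>L C \<preceq> \<sigma> (C o\<^sub>L A o\<^sub>L C) (C o\<^sub>L B o\<^sub>L C)) \<and>
     (\<forall>X Y. \<forall>A\<in>pos_ops. \<forall>B\<in>pos_ops. range X \<subseteq> pos_ops \<longrightarrow> range Y \<subseteq> pos_ops \<longrightarrow>
        X \<down> A \<longrightarrow> Y \<down> B \<longrightarrow> (\<lambda>n. \<sigma> (X n) (Y n)) \<down> \<sigma> A B)"

definition kubo_ando_mean :: "'h::complex_hilbert_space binop \<Rightarrow> bool" where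
  "kubo_ando_mean \<sigma> \<longleftrightarrow> connection \<sigma> \<and> \<sigma> id_blinfun id_blinfun = id_blinfun"

definition symmetric_binop :: "'h::complex_hilbert_space binop \<Rightarrow> bool" where
  "symmetric_binop \<sigma> \<longleftrightarrow> (\<forall>A\<in>pos_ops. \<forall>B\<in>pos_ops. \<sigma> A B = \<sigma> B A)"

text \<open>The values of the members of this class on \<open>(-\<infinity>, 0]\<close> are arbitrary and never used.\<close>

definition OM_plus :: "(complex \<Rightarrow> complex) set" where
  "OM_plus = {f. f analytic_on (- \<real>\<^sub>\<le>\<^sub>0) \<and>
                 (\<forall>x>0. f (complex_of_real x) \<in> \<real>\<^sub>\<ge>\<^sub>0) \<and>
                 (\<forall>z. Im z > 0 \<longrightarrow> Im (f z) \<ge> 0)}"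

text \<open>
  This says \<open>\<sigma> = \<sigma>\<^sub>f\<close>: since \<open>A + I/n\<close> is invertible and decreases to \<open>A\<close>, a connection is
  determined by its values on the invertible positive operators.
\<close>

definition representing_function ::
    "(complex \<Rightarrow> complex) \<Rightarrow> 'h::complex_hilbert_space binop \<Rightarrow> bool" where
  "representing_function f \<sigma> \<longleftrightarrow>
     f \<in> OM_plus \<and> connection \<sigma> \<and>
     (\<forall>A\<in>pos_inv_ops. \<forall>B\<in>pos_inv_ops.
        \<sigma> A B = op_sqrt A
                o\<^sub>L fun_calc f (op_inv (op_sqrt A) o\<^sub>L B o\<^sub>L op_inv (op_sqrt A))
                o\<^sub>L op_sqrt A)"

definition molnar_mean :: "'h::complex_hilbert_space binop \<Rightarrow> bool" where
  "molnar_mean \<sigma> \<longleftrightarrow>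
     kubo_ando_mean \<sigma> \<and> symmetric_binop \<sigma> \<and>
     (\<exists>f. representing_function f \<sigma> \<and>
          (\<exists>c::real. c > 0 \<and> c \<noteq> 1 \<and>
             (\<forall>x::real. x > 0 \<longrightarrow>
                f (complex_of_real (c\<^sup>2 * x)) = complex_of_real c * f (complex_of_real x))))"

end

theory Submission
  imports Defs "HOL-Complex_Analysis.Complex_Analysis"
    "HOL-Computational_Algebra.Fundamental_Theorem_Algebra" "HOL-Real_Asymp.Real_Asymp"
begin

text \<open>
  For \<open>d > 1\<close> and \<open>s\<^sub>n = d\<^bsup>2n+1\<^esup>\<close> put
  \<open>f(x) = K\<^sup>-\<^sup>1 \<Sum>\<^sub>n (s\<^sub>n x / (1 + s\<^sub>n\<^sup>2 x) + s\<^sub>n x / (s\<^sub>n\<^sup>2 + x))\<close>, where \<open>K\<close> makes \<open>f(1) = 1\<close>.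
  The two families of summands together are indexed by all odd powers of \<open>d\<close>, so an index shift gives
  \<open>f(d\<^sup>4 x) = d\<^sup>2 f(x)\<close>. The summands are the representing functions of multiples of parallel sums,
  \<open>A \<sigma>\<^sub>f B = K\<^sup>-\<^sup>1 \<Sum>\<^sub>n s\<^sub>n\<^sup>-\<^sup>1 (A : s\<^sub>n\<^sup>2 B + s\<^sub>n\<^sup>2 A : B)\<close>. The quadratic form of \<open>A : B\<close> at \<open>x\<close> is
  the infimum over \<open>y\<close> of \<open>\<langle>y, A y\<rangle> + \<langle>x - y, B (x - y)\<rangle>\<close>, from which the three connection axioms can
  be read off. Finally \<open>f(4) < 5/2\<close> for every \<open>d\<close>, but \<open>f(4) \<rightarrow> 5/2\<close> as \<open>d \<rightarrow> \<infinity>\<close> (the means approach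
  the arithmetic mean), so infinitely many of the means are distinct.
\<close>

section \<open>The inner product\<close>

text \<open>The two families are one family: d^(-m) x / (1 + d^(-2m) x) = d^m x / (d^(2m) + x), so K
  f(x) is the sum of d^k x / (1 + d^(2k) x) over all odd integers k. The reflection k -> -k
  exchanges A and B and gives symmetry; the shift k -> k + 2 gives the scaling law with c = d^2. Two
  obstacles shape the proof. A connection must be defined on singular operators too, where the
  formula with A^(-1/2) has no meaning; the infimum describing a parallel sum does not see the
  difference. Moreover, functional calculus and square root are definite descriptions, about which
  nothing can be said before existence and uniqueness. Both properties of the calculus rest on one
  estimate: ||p(A)|| is at most |p(w)| for some w in the spectrum. It is obtained by factoring
  polynomials and inverting coercive operators. The number 5/2 is the arithmetic mean of 1 and 4. As
  a bound that is approached but never attained, it forces infinitely many values f(4).\<close>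

lemma cinner_add_left: "cinner (x + y) z = cinner x z + cinner (y::'h::complex_hilbert_space) z"
  by (metis cinner_commute cinner_add_right complex_cnj_add)

lemma cinner_scaleC_left: "cinner (a *\<^sub>C x) (y::'h::complex_hilbert_space) = cnj a * cinner x y"
  by (metis cinner_commute cinner_scaleC_right complex_cnj_mult)

lemma cinner_scaleR_right: "cinner x (r *\<^sub>R (y::'h::complex_hilbert_space)) = complex_of_real r * cinner x y"
  by (metis cinner_scaleC_right scaleC_of_real)

lemma cinner_scaleR_left: "cinner (r *\<^sub>R x) (y::'h::complex_hilbert_space) = complex_of_real r * cinner x y"
  by (metis cinner_scaleC_left scaleC_of_real complex_cnj_complex_of_real)

lemma cinner_minus_right: "cinner x (- (y::'h::complex_hilbert_space)) = - cinner x y"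
  using cinner_scaleR_right[of x "-1" y] by simp

lemma cinner_minus_left: "cinner (- x) (y::'h::complex_hilbert_space) = - cinner x y"
  using cinner_scaleR_left[of "-1" x y] by simp

lemma cinner_diff_right: "cinner x (y - (z::'h::complex_hilbert_space)) = cinner x y - cinner x z"
  using cinner_add_right[of x y "- z"] by (simp add: cinner_minus_right)

lemma cinner_diff_left: "cinner (x - y) (z::'h::complex_hilbert_space) = cinner x z - cinner y z"
  using cinner_add_left[of x "- y" z] by (simp add: cinner_minus_left)

lemma cinner_zero [simp]:
  "cinner 0 (y::'h::complex_hilbert_space) = 0" "cinner y 0 = 0"
  using cinner_scaleR_left[of 0 0 y] cinner_scaleR_right[of y 0 0] by simp_all

lemmas cinner_simps = cinner_add_left cinner_add_right cinner_diff_left cinner_diff_right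
  cinner_scaleC_left cinner_scaleC_right cinner_scaleR_left cinner_scaleR_right
  cinner_minus_left cinner_minus_right

lemma scaleC_one [simp]: "1 *\<^sub>C (x::'h::complex_hilbert_space) = x"
  using scaleC_of_real[of 1 x] by simp

lemma scaleC_zero [simp]: "0 *\<^sub>C (x::'h::complex_hilbert_space) = 0" "a *\<^sub>C (0::'h) = 0"
  using scaleC_of_real[of 0 x] norm_scaleC[of a 0] by simp_all

lemma scaleC_minus_right: "a *\<^sub>C (- x) = - (a *\<^sub>C (x::'h::complex_hilbert_space))"
  using scaleC_add_right[of a x "-x"] by (simp add: add_eq_0_iff)

lemma scaleC_diff_right: "a *\<^sub>C (x - y) = a *\<^sub>C x - a *\<^sub>C (y::'h::complex_hilbert_space)"
  using scaleC_add_right[of a x "-y"] by (simp add: scaleC_minus_right)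

lemma scaleC_scaleR: "a *\<^sub>C r *\<^sub>R x = r *\<^sub>R a *\<^sub>C (x::'h::complex_hilbert_space)"
  by (metis scaleC_of_real scaleC_scaleC mult.commute)

lemma Re_cinner_commute: "Re (cinner y x) = Re (cinner x (y::'h::complex_hilbert_space))"
  by (subst cinner_commute) simp

lemma norm_add_square:
  "(norm (x + y))\<^sup>2 = (norm x)\<^sup>2 + 2 * Re (cinner x y) + (norm (y::'h::complex_hilbert_space))\<^sup>2"
proof -
  have "(norm (x + y))\<^sup>2 = Re (cinner (x + y) (x + y))"
    by (simp add: cinner_self)
  also have "\<dots> = (norm x)\<^sup>2 + (Re (cinner x y) + Re (cinner y x)) + (norm y)\<^sup>2"
    unfolding cinner_add_left cinner_add_right by (simp add: cinner_self)
  also have "Re (cinner y x) = Re (cinner x y)"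
    by (rule Re_cinner_commute)
  finally show ?thesis by simp
qed

lemma norm_diff_square:
  "(norm (x - y))\<^sup>2 = (norm x)\<^sup>2 - 2 * Re (cinner x y) + (norm (y::'h::complex_hilbert_space))\<^sup>2"
  using norm_add_square[of x "-y"] by (simp add: cinner_minus_right)

text \<open>Expanding the square of ||y|| x - ||x|| y gives 2 ||x|| ||y|| times the difference of
  the two sides, so no quotient has to be formed.\<close>

lemma Re_cinner_le: "Re (cinner x y) \<le> norm x * norm (y::'h::complex_hilbert_space)"
proof (cases "norm x * norm y = 0")
  case False
  have "0 \<le> (norm (norm y *\<^sub>R x - norm x *\<^sub>R y))\<^sup>2" by simp
  also have "\<dots> = 2 * (norm x * norm y) * (norm x * norm y - Re (cinner x y))"
    unfolding norm_diff_square by (simp add: cinner_simps power2_eq_square algebra_simps)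
  finally have "0 \<le> 2 * (norm x * norm y) * (norm x * norm y - Re (cinner x y))" .
  moreover have "2 * (norm x * norm y) > 0" using False by simp
  ultimately have "0 \<le> norm x * norm y - Re (cinner x y)" by (metis zero_le_mult_iff not_less)
  then show ?thesis by simp
qed auto

lemma norm_cinner_le: "cmod (cinner x y) \<le> norm x * norm (y::'h::complex_hilbert_space)"
proof -
  \<comment> \<open>Multiplying y by this phase makes the inner product real and nonnegative, so the
    bound on real parts applies.\<close>
  let ?a = "cnj (sgn (cinner x y))"
  have "complex_of_real (cmod (cinner x y)) = cinner x (?a *\<^sub>C y)"
    unfolding cinner_scaleC_right
    by (cases "cinner x y = 0")
       (simp_all add: sgn_eq complex_norm_square[symmetric] power2_eq_square field_simps)
  then have "cmod (cinner x y) = Re (cinner x (?a *\<^sub>C y))"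
    by (metis Re_complex_of_real)
  also have "\<dots> \<le> norm x * norm (?a *\<^sub>C y)" by (rule Re_cinner_le)
  also have "\<dots> \<le> norm x * norm y"
    by (intro mult_left_mono) (auto simp: norm_scaleC norm_sgn)
  finally show ?thesis .
qed

lemma bounded_bilinear_cinner: "bounded_bilinear (cinner :: 'h::complex_hilbert_space \<Rightarrow> 'h \<Rightarrow> complex)"
  by standard (auto simp: cinner_simps scaleR_conv_of_real intro!: exI[of _ 1] norm_cinner_le)

lemmas tendsto_cinner [tendsto_intros] = bounded_bilinear.tendsto[OF bounded_bilinear_cinner]

lemma bounded_linear_scaleC: "bounded_linear (\<lambda>x::'h::complex_hilbert_space. a *\<^sub>C x)"
  by (rule bounded_linear_intro[of _ "cmod a"])
     (auto simp: scaleC_add_right scaleC_scaleR norm_scaleC mult.commute)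

lemma id_compose [simp]: "id_blinfun o\<^sub>L A = A" "A o\<^sub>L id_blinfun = A"
  by (rule blinfun_eqI, simp)+

lemma compose_assoc: "(A o\<^sub>L B) o\<^sub>L C = A o\<^sub>L (B o\<^sub>L C)"
  by (rule blinfun_eqI) simp

lemmas tendsto_scaleC [tendsto_intros] = bounded_linear.tendsto[OF bounded_linear_scaleC]

section \<open>Complex linear and symmetric operators\<close>

lemma bounded_opsD: "A \<in> bounded_ops \<Longrightarrow> A (a *\<^sub>C x) = a *\<^sub>C A x"
  by (simp add: bounded_ops_def)

lemma bounded_ops_closed [simp, intro]:
  "0 \<in> bounded_ops" "id_blinfun \<in> bounded_ops"
  "A \<in> bounded_ops \<Longrightarrow> B \<in> bounded_ops \<Longrightarrow> A + B \<in> bounded_ops"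
  "A \<in> bounded_ops \<Longrightarrow> B \<in> bounded_ops \<Longrightarrow> A - B \<in> bounded_ops"
  "A \<in> bounded_ops \<Longrightarrow> r *\<^sub>R A \<in> bounded_ops"
  "A \<in> bounded_ops \<Longrightarrow> op_scaleC c A \<in> bounded_ops"
  "A \<in> bounded_ops \<Longrightarrow> B \<in> bounded_ops \<Longrightarrow> A o\<^sub>L B \<in> bounded_ops"
  by (simp_all add: bounded_ops_def plus_blinfun.rep_eq minus_blinfun.rep_eq scaleR_blinfun.rep_eq
      zero_blinfun.rep_eq scaleC_add_right scaleC_diff_right scaleC_scaleR op_scaleC.rep_eq
      scaleC_scaleC mult.commute[of c])

lemma strong_limit_bounded_ops:
  fixes A :: "'h::complex_hilbert_space \<Rightarrow>\<^sub>L 'h"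
    and X :: "nat \<Rightarrow> 'h \<Rightarrow>\<^sub>L 'h"
  assumes "\<And>x. (\<lambda>n. X n x) \<longlonglongrightarrow> A x" "\<And>n. X n \<in> bounded_ops"
  shows "A \<in> bounded_ops"
proof -
  have "A (a *\<^sub>C x) = a *\<^sub>C A x" for a x
  proof (rule LIMSEQ_unique)
    show "(\<lambda>n. X n (a *\<^sub>C x)) \<longlonglongrightarrow> A (a *\<^sub>C x)" by (rule assms)
    show "(\<lambda>n. X n (a *\<^sub>C x)) \<longlonglongrightarrow> a *\<^sub>C A x"
      unfolding bounded_opsD[OF assms(2)] by (intro tendsto_intros assms)
  qed
  then show ?thesis by (simp add: bounded_ops_def)
qed

text \<open>Self-adjointness expressed through the inner product, so that no adjoint operator has to
  be constructed.\<close>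

definition op_symmetric :: "('h::complex_hilbert_space \<Rightarrow>\<^sub>L 'h) \<Rightarrow> bool" where
  "op_symmetric A \<longleftrightarrow> A \<in> bounded_ops \<and> (\<forall>x y. cinner x (A y) = cinner (A x) y)"

definition op_form :: "('h::complex_hilbert_space \<Rightarrow>\<^sub>L 'h) \<Rightarrow> 'h \<Rightarrow> real" where
  "op_form A x = Re (cinner x (A x))"

lemma op_symmetric_bounded_ops: "op_symmetric A \<Longrightarrow> A \<in> bounded_ops"
  by (simp add: op_symmetric_def)

lemma op_symmetricD: "op_symmetric A \<Longrightarrow> cinner x (A y) = cinner (A x) y"
  by (simp add: op_symmetric_def)

lemma op_symmetric_closed [simp, intro]:
  "op_symmetric 0" "op_symmetric id_blinfun"
  "op_symmetric A \<Longrightarrow> op_symmetric B \<Longrightarrow> op_symmetric (A + B)"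
  "op_symmetric A \<Longrightarrow> op_symmetric B \<Longrightarrow> op_symmetric (A - B)"
  "op_symmetric A \<Longrightarrow> op_symmetric (r *\<^sub>R A)"
  unfolding op_symmetric_def
  by (auto simp: plus_blinfun.rep_eq minus_blinfun.rep_eq scaleR_blinfun.rep_eq cinner_simps)

lemma op_form_simps:
  "op_form 0 x = 0" "op_form id_blinfun x = (norm x)\<^sup>2"
  "op_form (A + B) x = op_form A x + op_form B x"
  "op_form (A - B) x = op_form A x - op_form B x"
  "op_form (r *\<^sub>R A) x = r * op_form A x"
  "op_form A 0 = 0"
  by (simp_all add: op_form_def plus_blinfun.rep_eq minus_blinfun.rep_eq scaleR_blinfun.rep_eq
      cinner_simps cinner_self)

lemma op_form_scaleR: "op_form A (r *\<^sub>R x) = r\<^sup>2 * op_form A x"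
  by (simp add: op_form_def blinfun.scaleR_right cinner_simps power2_eq_square)

lemma op_form_add:
  assumes "op_symmetric A"
  shows "op_form A (x + y) = op_form A x + 2 * Re (cinner x (A y)) + op_form A y"
proof -
  have "Re (cinner y (A x)) = Re (cinner x (A y))"
    by (simp only: op_symmetricD[OF assms] Re_cinner_commute[of "A y" x])
  then show ?thesis
    by (simp add: op_form_def blinfun.add_right cinner_simps)
qed

lemma abs_op_form_le: "\<bar>op_form A x\<bar> \<le> norm A * (norm x)\<^sup>2"
proof -
  have "\<bar>op_form A x\<bar> \<le> norm x * norm (A x)"
    unfolding op_form_def using abs_Re_le_cmod norm_cinner_le order_trans by blast
  also have "\<dots> \<le> norm x * (norm A * norm x)"
    by (intro mult_left_mono norm_blinfun) auto
  finally show ?thesis by (simp add: power2_eq_square algebra_simps)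
qed

lemma op_form_le: "op_form A x \<le> norm A * (norm x)\<^sup>2"
  using abs_op_form_le[of A x] by simp

lemma tendsto_op_form:
  fixes X :: "'a \<Rightarrow> 'h::complex_hilbert_space \<Rightarrow>\<^sub>L 'h"
    and A :: "'h \<Rightarrow>\<^sub>L 'h"
  shows "((\<lambda>n. X n x) \<longlongrightarrow> A x) F \<Longrightarrow> ((\<lambda>n. op_form (X n) x) \<longlongrightarrow> op_form A x) F"
  unfolding op_form_def by (intro tendsto_Re tendsto_cinner tendsto_const)

section \<open>Positive operators\<close>

text \<open>Over the complex scalars a real-valued quadratic form comes from a Hermitian operator:
  expanding at x + y makes the imaginary parts antisymmetric, and replacing x by i x turns this into
  symmetry of the real parts.\<close>

lemma pos_ops_symmetric:
  assumes "A \<in> pos_ops"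
  shows "op_symmetric (A :: 'h::complex_hilbert_space \<Rightarrow>\<^sub>L 'h)"
proof -
  have A: "A (a *\<^sub>C x) = a *\<^sub>C A x" for a x
    using assms by (simp add: pos_ops_def bounded_ops_def)
  have re: "Im (cinner x (A x)) = 0" for x
    using assms by (auto simp: pos_ops_def complex_nonneg_Reals_iff)
  have im: "Im (cinner x (A y)) = - Im (cinner y (A x))" for x y
    using re[of "x + y"] by (simp add: cinner_simps blinfun.add_right re)
  have "Re (cinner x (A y)) = Re (cinner y (A x))" for x y
    using im[of "\<i> *\<^sub>C x" y] by (simp add: A cinner_simps)
  then have "cinner x (A y) = cnj (cinner y (A x))" for x y
    using im[of x y] by (intro complex_eqI) (simp_all only: cnj.sel)
  then have "cinner x (A y) = cinner (A x) y" for x y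
    by (rule trans[OF _ cinner_commute[symmetric]])
  then show ?thesis
    using assms by (simp add: op_symmetric_def pos_ops_def)
qed

lemma pos_ops_iff: "A \<in> pos_ops \<longleftrightarrow> op_symmetric A \<and> (\<forall>x. op_form A x \<ge> 0)"
proof safe
  fix x assume "A \<in> pos_ops"
  then show "op_form A x \<ge> 0"
    by (auto simp: op_form_def pos_ops_def complex_nonneg_Reals_iff)
next
  assume A: "op_symmetric A" "\<forall>x. 0 \<le> op_form A x"
  have "cinner x (A x) = cnj (cinner x (A x))" for x
    by (rule trans[OF op_symmetricD[OF A(1)] cinner_commute])
  then have "Im (cinner x (A x)) = 0" for x
    using arg_cong[of _ _ Im] by fastforce
  then show "A \<in> pos_ops"
    using A(2) op_symmetric_bounded_ops[OF A(1)]
    by (auto simp: op_form_def pos_ops_def complex_nonneg_Reals_iff)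
qed (rule pos_ops_symmetric)

lemma pos_opsD: "A \<in> pos_ops \<Longrightarrow> op_form A x \<ge> 0"
  by (simp add: pos_ops_iff)

lemma pos_ops_bounded_ops: "A \<in> pos_ops \<Longrightarrow> A \<in> bounded_ops"
  by (simp add: pos_ops_def)

lemma pos_ops_closed [simp, intro]:
  "0 \<in> pos_ops" "id_blinfun \<in> pos_ops"
  "A \<in> pos_ops \<Longrightarrow> B \<in> pos_ops \<Longrightarrow> A + B \<in> pos_ops"
  "A \<in> pos_ops \<Longrightarrow> r \<ge> 0 \<Longrightarrow> r *\<^sub>R A \<in> pos_ops"
  by (auto simp: pos_ops_iff op_form_simps)

lemma loewner_leD: "A \<preceq> B \<Longrightarrow> op_form A x \<le> op_form B x"
  using pos_opsD[of "B - A" x] by (simp add: loewner_le_def op_form_simps)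

lemma loewner_le_iff:
  "op_symmetric A \<Longrightarrow> op_symmetric B \<Longrightarrow> A \<preceq> B \<longleftrightarrow> (\<forall>x. op_form A x \<le> op_form B x)"
  by (auto simp: loewner_le_def op_form_simps pos_ops_iff)

lemma op_form_conj:
  assumes "op_symmetric C"
  shows "op_form (C o\<^sub>L A o\<^sub>L C) x = op_form A (C x)"
  by (simp add: op_form_def op_symmetricD[OF assms])

lemma op_symmetric_conj: "op_symmetric A \<Longrightarrow> op_symmetric C \<Longrightarrow> op_symmetric (C o\<^sub>L A o\<^sub>L C)"
  by (auto simp: op_symmetric_def)

lemma pos_ops_conj: "A \<in> pos_ops \<Longrightarrow> op_symmetric C \<Longrightarrow> C o\<^sub>L A o\<^sub>L C \<in> pos_ops"
  by (auto simp: pos_ops_iff op_form_conj op_symmetric_conj)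

text \<open>Evaluate the form of \<open>D\<close> at \<open>x - D x / \<parallel>D\<parallel>\<close>.\<close>

lemma pos_ops_norm_apply:
  assumes "D \<in> pos_ops"
  shows "(norm (D x))\<^sup>2 \<le> norm D * op_form D x"
proof (cases "norm D = 0")
  case False
  define t where "t = 1 / norm D"
  have t: "t > 0" "t * norm D = 1" using False by (auto simp: t_def)
  have sym: "op_symmetric D" using assms by (rule pos_ops_symmetric)
  have "0 \<le> op_form D (x + (-t) *\<^sub>R D x)" using assms by (rule pos_opsD)
  also have "\<dots> = op_form D x - 2 * t * (norm (D x))\<^sup>2 + t\<^sup>2 * op_form D (D x)"
    by (simp only: op_form_add[OF sym] op_form_scaleR)
       (simp add: blinfun.scaleR_right cinner_simps cinner_self op_symmetricD[OF sym] blinfun.minus_right)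
  also have "\<dots> \<le> op_form D x - 2 * t * (norm (D x))\<^sup>2 + t\<^sup>2 * (norm D * (norm (D x))\<^sup>2)"
    using op_form_le[of D "D x"] by (intro add_left_mono mult_left_mono) auto
  also have "t\<^sup>2 * (norm D * (norm (D x))\<^sup>2) = t * (t * norm D) * (norm (D x))\<^sup>2"
    by (simp add: power2_eq_square)
  finally have "t * (norm (D x))\<^sup>2 \<le> op_form D x" using t by simp
  then have "norm D * (t * (norm (D x))\<^sup>2) \<le> norm D * op_form D x"
    by (intro mult_left_mono) auto
  then show ?thesis using t by (metis mult.assoc mult.commute mult_1)
qed auto

text \<open>Together with \<open>pos_ops_norm_apply\<close> the bound on the form gives ||D||^2 <= c
  ||D||, and one factor cancels. Norm estimates for positive operators thus reduce to estimates of
  forms.\<close>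

lemma pos_ops_norm_le:
  assumes "D \<in> pos_ops" "c \<ge> 0" "\<And>x. op_form D x \<le> c * (norm x)\<^sup>2"
  shows "norm D \<le> c"
proof (cases "norm D = 0")
  case False
  have "norm (D x) \<le> sqrt (norm D * c) * norm x" for x
  proof (rule power2_le_imp_le)
    have "(norm (D x))\<^sup>2 \<le> norm D * op_form D x" by (rule pos_ops_norm_apply[OF assms(1)])
    also have "\<dots> \<le> norm D * (c * (norm x)\<^sup>2)" by (intro mult_left_mono assms) auto
    also have "\<dots> = (sqrt (norm D * c) * norm x)\<^sup>2"
      using assms(2) by (simp add: power_mult_distrib)
    finally show "(norm (D x))\<^sup>2 \<le> (sqrt (norm D * c) * norm x)\<^sup>2" .
  qed (use assms in auto)
  then have "norm D \<le> sqrt (norm D * c)"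
    by (intro norm_blinfun_bound) (use assms(2) in auto)
  then have "norm D ^ 2 \<le> norm D * c"
    by (metis assms(2) mult_nonneg_nonneg norm_ge_zero real_le_rsqrt real_sqrt_ge_zero real_sqrt_pow2 power_mono)
  then show ?thesis using False by (simp add: power2_eq_square)
qed (use assms in auto)

lemma loewner_le_norm:
  assumes "A \<in> pos_ops" "A \<preceq> B"
  shows "norm A \<le> norm B"
  by (rule pos_ops_norm_le[OF assms(1)])
     (auto intro: order_trans[OF loewner_leD[OF assms(2)] op_form_le])

text \<open>The difference is positive with zero form, so its norm is at most 0. This makes
  operators that are specified by their forms unique.\<close>

lemma pos_ops_eqI:
  assumes "A \<in> pos_ops" "B \<in> pos_ops" "\<And>x. op_form A x = op_form B x"
  shows "A = B"
proof -
  have "A - B \<in> pos_ops"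
    using assms by (simp add: pos_ops_iff op_form_simps op_symmetric_closed)
  then have "norm (A - B) \<le> 0"
    by (rule pos_ops_norm_le) (simp_all add: op_form_simps assms)
  then show ?thesis by simp
qed

lemma pos_ops_strong_limit:
  fixes A :: "'h::complex_hilbert_space \<Rightarrow>\<^sub>L 'h"
    and X :: "nat \<Rightarrow> 'h \<Rightarrow>\<^sub>L 'h"
  assumes lim: "\<And>x. (\<lambda>n. X n x) \<longlonglongrightarrow> A x" and pos: "\<And>n. X n \<in> pos_ops"
  shows "A \<in> pos_ops"
proof -
  have "A \<in> bounded_ops"
    by (rule strong_limit_bounded_ops[OF lim pos_ops_bounded_ops[OF pos]])
  moreover have "cinner x (A y) = cinner (A x) y" for x y
    by (rule LIMSEQ_unique[OF tendsto_cinner[OF tendsto_const lim]])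
       (unfold op_symmetricD[OF pos_ops_symmetric[OF pos]], intro tendsto_intros lim)
  moreover have "op_form A x \<ge> 0" for x
    by (rule LIMSEQ_le_const[OF tendsto_op_form[where X = X, OF lim]]) (use pos_opsD[OF pos] in auto)
  ultimately show ?thesis by (simp add: pos_ops_iff op_symmetric_def)
qed

section \<open>Monotone limits\<close>

text \<open>The strong operator topology is pulled back from the product topology: continuity of the
  evaluations gives one direction, componentwise convergence in the product the other.\<close>

lemma strong_limitin_iff:
  "limitin strong_operator_topology X A sequentially \<longleftrightarrow> (\<forall>x. (\<lambda>n. X n x) \<longlonglongrightarrow> A x)"
proof
  assume lim: "limitin strong_operator_topology X A sequentially"
  show "\<forall>x. (\<lambda>n. X n x) \<longlonglongrightarrow> A x"
  proof
    fix x
    have "limitin euclidean ((\<lambda>f. blinfun_apply f x) \<circ> X) (A x) sequentially"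
      by (rule continuous_map_limit[OF strong_operator_topology_continuous_evaluation lim])
    then show "(\<lambda>n. X n x) \<longlonglongrightarrow> A x" by (simp add: o_def)
  qed
next
  assume lim: "\<forall>x. (\<lambda>n. X n x) \<longlonglongrightarrow> A x"
  show "limitin strong_operator_topology X A sequentially"
    unfolding limitin_def
  proof (intro conjI allI impI)
    fix U assume U: "openin strong_operator_topology U \<and> A \<in> U"
    then obtain V where V: "open V" "U = blinfun_apply -` V"
      by (auto simp: strong_operator_topology_def openin_pullback_topology)
    have "(\<lambda>n. blinfun_apply (X n)) \<longlonglongrightarrow> blinfun_apply A"
      using lim unfolding limitin_canonical_iff[symmetric] euclidean_product_topology[symmetric]
      by (simp add: limitin_componentwise)
    from topological_tendstoD[OF this V(1)] show "\<forall>\<^sub>F n in sequentially. X n \<in> U"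
      using U V by auto
  qed (simp add: strong_operator_topology_topspace)
qed

text \<open>The forms converge, being decreasing and bounded below. Applied to X m - X n, the
  estimate \<open>pos_ops_norm_apply\<close> turns this into Cauchy sequences of vectors, because
  these differences have norm at most ||X 0||.\<close>

lemma pos_ops_decreasing_limit:
  fixes X :: "nat \<Rightarrow> 'h::complex_hilbert_space \<Rightarrow>\<^sub>L 'h"
  assumes pos: "\<And>n. X n \<in> pos_ops" and dec: "\<And>n. X (Suc n) \<preceq> X n"
  obtains A where "A \<in> pos_ops" "X \<down> A"
proof -
  have form_dec: "decseq (\<lambda>n. op_form (X n) x)" for x
    unfolding decseq_Suc_iff using loewner_leD[OF dec] by auto
  have form_conv: "convergent (\<lambda>n. op_form (X n) x)" for x
    using decseq_convergent[OF form_dec, of 0 x] pos_opsD[OF pos] by (metis convergentI)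
  have nonneg: "norm (X 0) \<ge> 0" by simp
  have diff: "(norm (X m x - X n x))\<^sup>2 \<le> norm (X 0) * (op_form (X m) x - op_form (X n) x)"
    if "m \<le> n" for m n x
  proof -
    have D: "X m - X n \<in> pos_ops"
      using form_dec that pos by (auto simp: pos_ops_iff op_form_simps decseq_def op_symmetric_closed)
    have "op_form (X m - X n) x \<le> norm (X 0) * (norm x)\<^sup>2" for x
      using form_dec[of x] pos_opsD[OF pos, of n x] op_form_le[of "X 0" x]
      by (auto simp: op_form_simps decseq_def dest: spec[of _ 0] intro: order_trans)
         (smt (verit, best) le0)
    then have "norm (X m - X n) \<le> norm (X 0)" by (intro pos_ops_norm_le D) auto
    then have "norm (X m - X n) * op_form (X m - X n) x \<le> norm (X 0) * op_form (X m - X n) x"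
      by (intro mult_right_mono pos_opsD[OF D])
    with pos_ops_norm_apply[OF D, of x] show ?thesis
      by (simp add: minus_blinfun.rep_eq op_form_simps)
  qed
  have cauchy: "Cauchy (\<lambda>n. X n x)" for x
  proof (rule metric_CauchyI)
    fix e :: real assume e: "e > 0"
    \<comment> \<open>The \<open>+ 1\<close> keeps the quotient meaningful when
      \<open>X 0 = 0\<close>.\<close>
    define c where "c = e\<^sup>2 / (norm (X 0) + 1)"
    have c: "c > 0" unfolding c_def using e by (intro divide_pos_pos add_nonneg_pos) auto
    from form_conv[of x] have "Cauchy (\<lambda>n. op_form (X n) x)" by (rule convergent_Cauchy)
    from metric_CauchyD[OF this c] obtain M where
      M: "\<And>m n. m \<ge> M \<Longrightarrow> n \<ge> M \<Longrightarrow> dist (op_form (X m) x) (op_form (X n) x) < c" by blast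
    have *: "norm (X m x - X n x) < e" if "M \<le> m" "m \<le> n" for m n
    proof (rule power2_less_imp_less)
      have "(norm (X m x - X n x))\<^sup>2 \<le> norm (X 0) * (op_form (X m) x - op_form (X n) x)"
        using that by (intro diff)
      also have "\<dots> \<le> norm (X 0) * c"
        using M[of m n] that by (intro mult_left_mono) (auto simp: dist_real_def)
      also have "\<dots> < (norm (X 0) + 1) * c" using c by (simp add: algebra_simps)
      also have "\<dots> = e\<^sup>2" using nonneg by (simp add: c_def add_nonneg_eq_0_iff)
      finally show "(norm (X m x - X n x))\<^sup>2 < e\<^sup>2" .
    qed (use e in auto)
    show "\<exists>M. \<forall>m\<ge>M. \<forall>n\<ge>M. dist (X m x) (X n x) < e"
    proof (intro exI allI impI)
      fix m n assume "M \<le> m" "M \<le> n"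
      then show "dist (X m x) (X n x) < e"
        using *[of m n] *[of n m] by (cases "m \<le> n") (auto simp: dist_norm norm_minus_commute)
    qed
  qed
  define L where "L x = lim (\<lambda>n. X n x)" for x
  have L: "(\<lambda>n. X n x) \<longlonglongrightarrow> L x" for x
    unfolding L_def using cauchy[of x] by (simp add: Cauchy_convergent_iff convergent_LIMSEQ_iff)
  have norm_X: "norm (X n) \<le> norm (X 0)" for n
  proof (rule pos_ops_norm_le[OF pos])
    show "op_form (X n) x \<le> norm (X 0) * (norm x)\<^sup>2" for x
      using form_dec[of x] op_form_le[of "X 0" x] unfolding decseq_def by (meson le0 order_trans)
  qed simp
  have "bounded_linear L"
  proof (rule bounded_linear_intro)
    fix x y :: 'h and r :: real
    show "L (x + y) = L x + L y"
      by (rule LIMSEQ_unique[OF L]) (unfold blinfun.add_right, intro tendsto_intros L)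
    show "L (r *\<^sub>R x) = r *\<^sub>R L x"
      by (rule LIMSEQ_unique[OF L]) (unfold blinfun.scaleR_right, intro tendsto_intros L)
    show "norm (L x) \<le> norm x * norm (X 0)"
    proof (rule LIMSEQ_le_const2[OF tendsto_norm[OF L]], intro exI allI impI)
      fix n
      have "norm (X n x) \<le> norm (X n) * norm x" by (rule norm_blinfun)
      also have "\<dots> \<le> norm (X 0) * norm x" by (intro mult_right_mono norm_X) auto
      finally show "norm (X n x) \<le> norm x * norm (X 0)" by (simp add: mult.commute)
    qed
  qed
  then have app: "blinfun_apply (Blinfun L) = L" by (rule bounded_linear_Blinfun_apply)
  have lim: "(\<lambda>n. X n x) \<longlonglongrightarrow> Blinfun L x" for x using L by (simp add: app)
  have "Blinfun L \<in> pos_ops" by (rule pos_ops_strong_limit[OF lim pos])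
  moreover have "X \<down> Blinfun L"
    unfolding decreases_to_def strong_limitin_iff using dec lim by auto
  ultimately show ?thesis using that by blast
qed

lemma decreases_to_form:
  assumes "X \<down> A"
  shows "(\<lambda>n. op_form (X n) x) \<longlonglongrightarrow> op_form A x" "decseq (\<lambda>n. op_form (X n) x)"
        "op_form A x \<le> op_form (X n) x"
proof -
  show 1: "(\<lambda>n. op_form (X n) x) \<longlonglongrightarrow> op_form A x"
    using assms by (intro tendsto_op_form) (auto simp: decreases_to_def strong_limitin_iff)
  show 2: "decseq (\<lambda>n. op_form (X n) x)"
    using assms by (auto simp: decreases_to_def decseq_Suc_iff intro: loewner_leD)
  show "op_form A x \<le> op_form (X n) x" using decseq_ge[OF 2 1] .
qed

text \<open>Monotonicity already provides some strong limit, so convergence of forms is enough to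
  identify it with \<open>A\<close>.\<close>

lemma decreases_toI:
  assumes pos: "\<And>n. X n \<in> pos_ops" "A \<in> pos_ops" and dec: "\<And>n. X (Suc n) \<preceq> X n"
    and lim: "\<And>x. (\<lambda>n. op_form (X n) x) \<longlonglongrightarrow> op_form A x"
  shows "X \<down> A"
proof -
  obtain B where B: "B \<in> pos_ops" "X \<down> B"
    using pos_ops_decreasing_limit[of X] pos(1) dec by blast
  have "op_form B x = op_form A x" for x
    using decreases_to_form(1)[OF B(2)] lim by (rule LIMSEQ_unique)
  then have "B = A" using B(1) pos(2) by (rule pos_ops_eqI[rotated 2])
  with B show ?thesis by simp
qed

section \<open>Invertible operators\<close>

lemma inverse_of_sym: "inverse_of A B \<Longrightarrow> A \<in> bounded_ops \<Longrightarrow> inverse_of B A"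
  by (simp add: inverse_of_def)

lemma inverse_of_unique:
  assumes "inverse_of A B" "inverse_of A C"
  shows "B = C"
proof -
  have "B = B o\<^sub>L (A o\<^sub>L C)" using assms by (simp add: inverse_of_def)
  also have "\<dots> = (B o\<^sub>L A) o\<^sub>L C" by (simp add: compose_assoc)
  finally show ?thesis using assms by (simp add: inverse_of_def)
qed

lemma inverse_of_op_inv: "op_invertible A \<Longrightarrow> inverse_of A (op_inv A)"
  unfolding op_inv_def op_invertible_def by (rule theI') (auto intro: inverse_of_unique)

lemma op_inv_simps:
  assumes "op_invertible A"
  shows "op_inv A \<in> bounded_ops" "A o\<^sub>L op_inv A = id_blinfun" "op_inv A o\<^sub>L A = id_blinfun"
    "A (op_inv A x) = x" "op_inv A (A x) = x"
proof -
  note inv = inverse_of_op_inv[OF assms, unfolded inverse_of_def]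
  then show "op_inv A \<in> bounded_ops" "A o\<^sub>L op_inv A = id_blinfun" "op_inv A o\<^sub>L A = id_blinfun"
    by auto
  show "A (op_inv A x) = x" "op_inv A (A x) = x"
    using inv by (metis blinfun_apply_blinfun_compose blinfun_apply_id_blinfun)+
qed

lemma op_invertible_id [simp]: "op_invertible id_blinfun"
  unfolding op_invertible_def inverse_of_def by (rule exI[of _ id_blinfun]) simp

lemma op_invertible_compose:
  assumes "op_invertible A" "op_invertible B"
  shows "op_invertible (A o\<^sub>L B)"
  unfolding op_invertible_def inverse_of_def
proof (intro exI conjI)
  show "op_inv B o\<^sub>L op_inv A \<in> bounded_ops" using op_inv_simps assms by auto
qed (rule blinfun_eqI, simp add: op_inv_simps assms)+

lemma op_invertible_scaleC:
  assumes "op_invertible A" "c \<noteq> 0"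
  shows "op_invertible (op_scaleC c A)"
  unfolding op_invertible_def inverse_of_def
proof (intro exI conjI)
  show "op_scaleC (inverse c) (op_inv A) \<in> bounded_ops" using op_inv_simps(1) assms by auto
  have "op_inv A (c *\<^sub>C x) = c *\<^sub>C op_inv A x" for x
    by (rule bounded_opsD[OF op_inv_simps(1)[OF assms(1)]])
  then show "op_scaleC (inverse c) (op_inv A) o\<^sub>L op_scaleC c A = id_blinfun"
    using assms by (intro blinfun_eqI) (simp add: op_scaleC.rep_eq op_inv_simps scaleC_scaleC)
  show "op_scaleC c A o\<^sub>L op_scaleC (inverse c) (op_inv A) = id_blinfun"
  proof (rule blinfun_eqI)
    fix x
    have "c *\<^sub>C A (inverse c *\<^sub>C op_inv A x) = A (op_inv A x)"
    proof -
      \<comment> \<open>Complex linearity is at hand for the inverse, so the scalar is moved into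
        \<open>op_inv A\<close> before \<open>A\<close> cancels it.\<close>
      have "inverse c *\<^sub>C op_inv A x = op_inv A (inverse c *\<^sub>C x)"
        by (simp add: bounded_opsD[OF op_inv_simps(1)[OF assms(1)]])
      then show ?thesis using assms by (simp add: op_inv_simps scaleC_scaleC)
    qed
    then show "(op_scaleC c A o\<^sub>L op_scaleC (inverse c) (op_inv A)) x = id_blinfun x"
      using assms by (simp add: op_scaleC.rep_eq op_inv_simps)
  qed
qed

text \<open>The inverse W of the product commutes with B, so B W is a two-sided inverse of A. This
  passes from a quadratic polynomial to a linear factor, and from an operator to its square
  root.\<close>

lemma op_invertible_commuting_factor:
  assumes "A \<in> bounded_ops" "B \<in> bounded_ops" "A o\<^sub>L B = B o\<^sub>L A" "op_invertible (A o\<^sub>L B)"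
  shows "op_invertible A"
proof -
  define W where "W = op_inv (A o\<^sub>L B)"
  note W = op_inv_simps(1-3)[OF assms(4), folded W_def]
  have "W o\<^sub>L B = (W o\<^sub>L B) o\<^sub>L (A o\<^sub>L B o\<^sub>L W)" using W by (simp add: compose_assoc)
  also have "\<dots> = (W o\<^sub>L (B o\<^sub>L A)) o\<^sub>L (B o\<^sub>L W)" by (simp add: compose_assoc)
  also have "\<dots> = B o\<^sub>L W" using W assms(3) by simp
  finally have "W o\<^sub>L B = B o\<^sub>L W" .
  then have "inverse_of A (B o\<^sub>L W)"
    unfolding inverse_of_def using W assms by (metis bounded_ops_closed(7) compose_assoc)
  then show ?thesis by (auto simp: op_invertible_def)
qed

lemma op_symmetric_op_inv:
  assumes "op_symmetric A" "op_invertible A"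
  shows "op_symmetric (op_inv A)"
  unfolding op_symmetric_def
proof (intro conjI allI)
  fix x y
  have "cinner x (op_inv A y) = cinner (A (op_inv A x)) (op_inv A y)"
    by (simp add: op_inv_simps assms)
  also have "\<dots> = cinner (op_inv A x) (A (op_inv A y))"
    using assms(1) by (rule op_symmetricD[symmetric])
  finally show "cinner x (op_inv A y) = cinner (op_inv A x) y"
    by (simp add: op_inv_simps assms)
qed (use op_inv_simps assms in auto)

text \<open>\<open>A x = y\<close> is a fixed point equation for \<open>x \<mapsto> x - (A x - y) / M\<close>, a contraction if \<open>M\<close> is large.\<close>

lemma coercive_surj:
  fixes A :: "'h::complex_hilbert_space \<Rightarrow>\<^sub>L 'h"
  assumes sym: "op_symmetric A" and d: "d > 0" and coercive: "\<And>x. d * (norm x)\<^sup>2 \<le> op_form A x"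
  shows "\<exists>x. A x = y"
proof -
  \<comment> \<open>M dominates ||A||, which makes id - A / M positive, and also d, which puts the
    contraction constant 1 - d / M into [0, 1).\<close>
  define M where "M = norm A + d"
  have M: "M > 0" "norm A \<le> M" "d \<le> M" unfolding M_def using d by (auto intro: add_nonneg_pos)
  define E where "E = id_blinfun - (1 / M) *\<^sub>R A"
  have form_E: "op_form E x = (norm x)\<^sup>2 - op_form A x / M" for x
    by (simp add: E_def op_form_simps)
  have "op_form E x \<ge> 0" for x
  proof -
    have "op_form A x \<le> M * (norm x)\<^sup>2"
      using op_form_le[of A x] mult_right_mono[OF M(2), of "(norm x)\<^sup>2"] by simp
    then show ?thesis using M by (simp add: form_E field_simps)
  qed
  then have E: "E \<in> pos_ops" using sym by (auto simp: pos_ops_iff E_def)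
  have norm_E: "norm E \<le> 1 - d / M"
  proof (rule pos_ops_norm_le[OF E])
    show "0 \<le> 1 - d / M" using M by simp
    show "op_form E x \<le> (1 - d / M) * (norm x)\<^sup>2" for x
      using coercive[of x] M by (simp add: form_E field_simps)
  qed
  have "\<exists>!x. E x + (1 / M) *\<^sub>R y = x"
  proof (rule banach_fix_type)
    show "0 \<le> 1 - d / M" "1 - d / M < 1" using M d by simp_all
    show "\<forall>u v. dist (E u + (1 / M) *\<^sub>R y) (E v + (1 / M) *\<^sub>R y) \<le> (1 - d / M) * dist u v"
    proof (intro allI)
      fix u v
      have "norm (E (u - v)) \<le> norm E * norm (u - v)" by (rule norm_blinfun)
      also have "\<dots> \<le> (1 - d / M) * norm (u - v)" using norm_E by (rule mult_right_mono) simp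
      finally show "dist (E u + (1 / M) *\<^sub>R y) (E v + (1 / M) *\<^sub>R y) \<le> (1 - d / M) * dist u v"
        by (simp add: dist_norm blinfun.diff_right)
    qed
  qed
  then obtain x where "E x + (1 / M) *\<^sub>R y = x" by blast
  then have "(1 / M) *\<^sub>R A x = (1 / M) *\<^sub>R y"
    by (simp add: E_def minus_blinfun.rep_eq scaleR_blinfun.rep_eq algebra_simps) auto
  then show ?thesis using M by (intro exI[of _ x]) auto
qed

lemma coercive_lower_bound:
  assumes "d * (norm x)\<^sup>2 \<le> op_form A x"
  shows "d * norm x \<le> norm (A x)"
proof (cases "x = 0")
  case False
  have "d * (norm x)\<^sup>2 \<le> norm x * norm (A x)"
    using assms Re_cinner_le[of x "A x"] by (simp add: op_form_def)
  then have "norm x * (d * norm x) \<le> norm x * norm (A x)"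
    by (simp add: power2_eq_square algebra_simps)
  then show ?thesis using False by simp
qed simp

text \<open>Coercivity gives d ||x|| <= ||A x||, which yields injectivity and bounds the inverse.
  Resolvents, sums of square roots and the denominators of parallel sums are inverted this
  way.\<close>

lemma coercive_invertible:
  fixes A :: "'h::complex_hilbert_space \<Rightarrow>\<^sub>L 'h"
  assumes sym: "op_symmetric A" and d: "d > 0" and coercive: "\<And>x. d * (norm x)\<^sup>2 \<le> op_form A x"
  shows "op_invertible A"
proof -
  have lower: "d * norm x \<le> norm (A x)" for x
    using coercive by (rule coercive_lower_bound)
  have inj: "x = y" if "A x = A y" for x y
    using lower[of "x - y"] that d by (simp add: blinfun.diff_right mult_le_0_iff)
  define g where "g = inv (blinfun_apply A)"
  have Ag: "A (g y) = y" for y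
    unfolding g_def using coercive_surj[OF assms] by (metis f_inv_into_f rangeI)
  have "bounded_linear g"
  proof (rule bounded_linear_intro)
    show "g (x + y) = g x + g y" "g (r *\<^sub>R x) = r *\<^sub>R g x" for x y r
      by (rule inj, simp add: Ag blinfun.add_right blinfun.scaleR_right)+
    show "norm (g x) \<le> norm x * (1 / d)" for x
      using lower[of "g x"] d by (simp add: Ag field_simps)
  qed
  then have app: "blinfun_apply (Blinfun g) = g" by (rule bounded_linear_Blinfun_apply)
  have "g (a *\<^sub>C x) = a *\<^sub>C g x" for a x
    by (rule inj) (simp add: Ag bounded_opsD[OF op_symmetric_bounded_ops[OF sym]])
  moreover have "g (A x) = x" for x
    by (rule inj) (simp add: Ag)
  ultimately have "inverse_of A (Blinfun g)"
    unfolding inverse_of_def bounded_ops_def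
    by (auto simp: app Ag intro!: blinfun_eqI)
  then show ?thesis by (auto simp: op_invertible_def)
qed

text \<open>A converse to \<open>coercive_invertible\<close>: ||x|| <= ||A^(-1)|| ||A x|| combines
  with \<open>pos_ops_norm_apply\<close>. The \<open>+ 1\<close> in the constant ensures that it can
  be divided by.\<close>

lemma pos_inv_ops_coercive:
  assumes "A \<in> pos_inv_ops"
  obtains d where "d > 0" "\<And>x. d * (norm x)\<^sup>2 \<le> op_form A x"
proof -
  have A: "A \<in> pos_ops" "op_invertible A" using assms by (auto simp: pos_inv_ops_def)
  define c where "c = ((norm (op_inv A))\<^sup>2 * norm A) + 1"
  have c: "c > 0" unfolding c_def by (intro add_nonneg_pos) auto
  have "1 / c * (norm x)\<^sup>2 \<le> op_form A x" for x
  proof -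
    have "norm x \<le> norm (op_inv A) * norm (A x)"
      using norm_blinfun[of "op_inv A" "A x"] by (simp add: op_inv_simps A)
    then have "(norm x)\<^sup>2 \<le> (norm (op_inv A))\<^sup>2 * (norm (A x))\<^sup>2"
      by (metis norm_ge_zero power_mono power_mult_distrib)
    also have "\<dots> \<le> (norm (op_inv A))\<^sup>2 * (norm A * op_form A x)"
      by (intro mult_left_mono pos_ops_norm_apply A) simp
    also have "\<dots> \<le> c * op_form A x"
      using pos_opsD[OF A(1), of x] by (simp add: c_def algebra_simps)
    finally show ?thesis using c by (simp add: field_simps)
  qed
  with c that[of "1 / c"] show ?thesis by simp
qed

section \<open>Polynomials of an operator\<close>

lemma op_scaleC_apply [simp]: "op_scaleC a A x = a *\<^sub>C A x"
  by (simp add: op_scaleC.rep_eq)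

lemma op_scaleC_of_real: "op_scaleC (complex_of_real r) A = r *\<^sub>R A"
  by (rule blinfun_eqI) (simp add: scaleR_blinfun.rep_eq scaleC_of_real)

lemma op_poly_conv_sum:
  assumes "degree p \<le> n"
  shows "op_poly p A = (\<Sum>i\<le>n. op_scaleC (coeff p i) (op_power A i))"
  unfolding op_poly_def
  by (rule sum.mono_neutral_left)
     (use assms in \<open>auto simp: coeff_eq_0 intro!: blinfun_eqI\<close>)

lemma op_poly_0 [simp]: "op_poly 0 A = 0"
  by (simp add: op_poly_def) (rule blinfun_eqI, simp)

lemma op_poly_pCons:
  assumes "A \<in> bounded_ops"
  shows "op_poly (pCons a p) A = op_scaleC a id_blinfun + (A o\<^sub>L op_poly p A)"
proof -
  have "op_poly (pCons a p) A = (\<Sum>i\<le>Suc (degree p). op_scaleC (coeff (pCons a p) i) (op_power A i))"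
    by (rule op_poly_conv_sum) (rule degree_pCons_le)
  also have "\<dots> = op_scaleC a id_blinfun
      + (\<Sum>i\<le>degree p. op_scaleC (coeff p i) (A o\<^sub>L op_power A i))"
    by (simp only: sum.atMost_Suc_shift) (simp add: op_power_def)
  also have "(\<Sum>i\<le>degree p. op_scaleC (coeff p i) (A o\<^sub>L op_power A i)) = A o\<^sub>L op_poly p A"
    unfolding op_poly_def bounded_bilinear.sum_right[OF bounded_bilinear_blinfun_compose]
    by (intro sum.cong refl blinfun_eqI) (simp add: bounded_opsD[OF assms])
  finally show ?thesis .
qed

lemma op_poly_pCons_apply:
  "A \<in> bounded_ops \<Longrightarrow> op_poly (pCons a p) A x = a *\<^sub>C x + A (op_poly p A x)"
  by (simp add: op_poly_pCons plus_blinfun.rep_eq)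

lemma op_poly_bounded_ops: "A \<in> bounded_ops \<Longrightarrow> op_poly p A \<in> bounded_ops"
  by (induction p) (auto simp: op_poly_pCons)

lemma op_poly_add:
  assumes "A \<in> bounded_ops"
  shows "op_poly (p + q) A = op_poly p A + op_poly q A"
proof (rule blinfun_eqI)
  show "op_poly (p + q) A x = (op_poly p A + op_poly q A) x" for x
    by (induction p q rule: poly_induct2)
       (simp_all add: op_poly_pCons_apply assms plus_blinfun.rep_eq blinfun.add_right scaleC_add_left)
qed

lemma op_poly_smult:
  assumes "A \<in> bounded_ops"
  shows "op_poly (smult c p) A = op_scaleC c (op_poly p A)"
proof (rule blinfun_eqI)
  show "op_poly (smult c p) A x = op_scaleC c (op_poly p A) x" for x
    by (induction p)
       (simp_all add: op_poly_pCons_apply assms bounded_opsD[OF assms] scaleC_add_right scaleC_scaleC)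
qed

lemma op_poly_mult:
  assumes "A \<in> bounded_ops"
  shows "op_poly (p * q) A = op_poly p A o\<^sub>L op_poly q A"
proof (rule blinfun_eqI)
  show "op_poly (p * q) A x = (op_poly p A o\<^sub>L op_poly q A) x" for x
    by (induction p)
       (simp_all add: op_poly_pCons_apply op_poly_add op_poly_smult assms plus_blinfun.rep_eq)
qed

lemma op_poly_diff:
  assumes "A \<in> bounded_ops"
  shows "op_poly (p - q) A = op_poly p A - op_poly q A"
  using op_poly_add[OF assms, of "p - q" q] by simp

lemma op_poly_const: "A \<in> bounded_ops \<Longrightarrow> op_poly [:c:] A = op_scaleC c id_blinfun"
  by (simp add: op_poly_pCons)

lemma scaleC_minus_left: "(- a) *\<^sub>C x = - (a *\<^sub>C (x::'h::complex_hilbert_space))"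
  using scaleC_add_left[of "- a" a x] by (simp add: eq_neg_iff_add_eq_0)

lemma op_poly_linear: "A \<in> bounded_ops \<Longrightarrow> op_poly [:- c, 1:] A = A - op_scaleC c id_blinfun"
  by (rule blinfun_eqI)
     (simp add: op_poly_pCons_apply minus_blinfun.rep_eq scaleC_minus_left)

lemma op_poly_commute:
  assumes A: "A \<in> bounded_ops" and T: "T \<in> bounded_ops" "T o\<^sub>L A = A o\<^sub>L T"
  shows "T o\<^sub>L op_poly p A = op_poly p A o\<^sub>L T"
proof (rule blinfun_eqI)
  have TA: "T (A x) = A (T x)" for x using T(2) by (metis blinfun_apply_blinfun_compose)
  show "(T o\<^sub>L op_poly p A) x = (op_poly p A o\<^sub>L T) x" for x
    by (induction p)
       (simp_all add: op_poly_pCons_apply A blinfun.add_right bounded_opsD[OF T(1)] TA)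
qed

text \<open>The adjoint of p(A) is thus again a polynomial in A, so the square of ||p(A)|| can be
  studied inside the commutative algebra of polynomials.\<close>

lemma op_poly_adjoint:
  assumes "op_symmetric A"
  shows "cinner x (op_poly p A y) = cinner (op_poly (map_poly cnj p) A x) y"
proof (induction p arbitrary: x)
  case (pCons a p)
  note A = op_symmetric_bounded_ops[OF assms]
  have comm: "A (op_poly q A x) = op_poly q A (A x)" for q
    using op_poly_commute[OF A A refl, of q] by (metis blinfun_apply_blinfun_compose)
  show ?case
    by (simp add: op_poly_pCons_apply A map_poly_pCons cinner_simps op_symmetricD[OF assms] pCons.IH comm)
qed simp

section \<open>The spectrum of a symmetric operator\<close>

text \<open>The product (A - z)(A - cnj z) equals (A - Re z)^2 + (Im z)^2, which is coercive when Im
  z is nonzero. The two factors commute, so A - z would be invertible.\<close>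

lemma op_spectrum_real:
  assumes "op_symmetric A" "z \<in> op_spectrum A"
  shows "z = complex_of_real (Re z)"
proof (rule ccontr)
  assume "z \<noteq> complex_of_real (Re z)"
  then have im: "Im z \<noteq> 0" by (auto simp: complex_eq_iff)
  note A = op_symmetric_bounded_ops[OF assms(1)]
  define S where "S = A - Re z *\<^sub>R id_blinfun"
  define T where "T = (S o\<^sub>L S) + (Im z)\<^sup>2 *\<^sub>R id_blinfun"
  have S: "op_symmetric S" unfolding S_def using assms by auto
  then have "op_symmetric (S o\<^sub>L S)" by (auto simp: op_symmetric_def)
  then have T_sym: "op_symmetric T" unfolding T_def by auto
  have "(Im z)\<^sup>2 * (norm x)\<^sup>2 \<le> op_form T x" for x
  proof -
    have "op_form (S o\<^sub>L S) x = (norm (S x))\<^sup>2"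
      by (simp add: op_form_def op_symmetricD[OF S] cinner_self)
    then show ?thesis by (simp add: T_def op_form_simps)
  qed
  then have "op_invertible T"
    using T_sym im by (intro coercive_invertible[of _ "(Im z)\<^sup>2"]) auto
  note fact = op_poly_linear[OF A]
  have "T = op_poly ([:- z, 1:] * [:- cnj z, 1:]) A"
  proof -
    have "[:- z, 1:] * [:- cnj z, 1:]
        = [:- complex_of_real (Re z), 1:] * [:- complex_of_real (Re z), 1:] + [:complex_of_real ((Im z)\<^sup>2):]"
      by (simp add: complex_eq_iff power2_eq_square)
    then show ?thesis
      by (simp only: op_poly_add op_poly_mult op_poly_const A fact T_def S_def op_scaleC_of_real)
  qed
  then have "T = (A - op_scaleC z id_blinfun) o\<^sub>L (A - op_scaleC (cnj z) id_blinfun)"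
    by (simp only: op_poly_mult A fact)
  with \<open>op_invertible T\<close>
  have inv: "op_invertible ((A - op_scaleC z id_blinfun) o\<^sub>L (A - op_scaleC (cnj z) id_blinfun))"
    by (simp only:)
  have "(A - op_scaleC z id_blinfun) o\<^sub>L (A - op_scaleC (cnj z) id_blinfun)
      = (A - op_scaleC (cnj z) id_blinfun) o\<^sub>L (A - op_scaleC z id_blinfun)"
    unfolding fact[symmetric] op_poly_mult[OF A, symmetric] by (simp only: mult.commute)
  from op_invertible_commuting_factor[OF _ _ this inv]
  have "op_invertible (A - op_scaleC z id_blinfun)"
    using A by simp
  then show False using assms(2) by (simp add: op_spectrum_def)
qed

text \<open>For r < a the operator A - r is coercive, and for r > b the operator r - A is.\<close>

lemma op_spectrum_subset:
  assumes sym: "op_symmetric A"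
    and "\<And>x. a * (norm x)\<^sup>2 \<le> op_form A x" "\<And>x. op_form A x \<le> b * (norm x)\<^sup>2"
  shows "op_spectrum A \<subseteq> complex_of_real ` {a..b}"
proof
  fix z assume z: "z \<in> op_spectrum A"
  define r where "r = Re z"
  have zr: "z = complex_of_real r" unfolding r_def using sym z by (rule op_spectrum_real)
  have ninv: "\<not> op_invertible (A - r *\<^sub>R id_blinfun)"
    using z by (simp add: op_spectrum_def zr op_scaleC_of_real)
  have "a \<le> r"
  proof (rule ccontr)
    assume "\<not> a \<le> r"
    then have "op_invertible (A - r *\<^sub>R id_blinfun)"
      using assms by (intro coercive_invertible[of _ "a - r"]) (auto simp: op_form_simps algebra_simps)
    with ninv show False ..
  qed
  moreover have "r \<le> b"
  proof (rule ccontr)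
    assume "\<not> r \<le> b"
    then have "op_invertible (r *\<^sub>R id_blinfun - A)"
      using assms by (intro coercive_invertible[of _ "r - b"]) (auto simp: op_form_simps algebra_simps)
    from op_invertible_scaleC[OF this, of "-1"]
    have "op_invertible (op_scaleC (complex_of_real (-1)) (r *\<^sub>R id_blinfun - A))" by simp
    with ninv show False unfolding op_scaleC_of_real by simp
  qed
  ultimately show "z \<in> complex_of_real ` {a..b}" using zr by auto
qed

text \<open>One half of spectral mapping: s splits into linear factors over the complex numbers, and
  a product of invertible operators is invertible, so some factor A - w is singular.\<close>

lemma op_poly_singular_root:
  assumes A: "A \<in> bounded_ops"
  shows "s \<noteq> 0 \<Longrightarrow> \<not> op_invertible (op_poly s A) \<Longrightarrow> \<exists>w\<in>op_spectrum A. poly s w = 0"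
proof (induction "degree s" arbitrary: s rule: less_induct)
  case less
  show ?case
  proof (cases "degree s = 0")
    case True
    then obtain c where "s = [:c:]" by (rule degree_eq_zeroE)
    then have "op_invertible (op_poly s A)"
      using less.prems(1) A by (simp add: op_poly_const op_invertible_scaleC)
    with less.prems(2) show ?thesis ..
  next
    case False
    then obtain w where w: "poly s w = 0"
      using Fundamental_Theorem_Algebra.fundamental_theorem_of_algebra[of s] by (auto simp: constant_degree)
    then obtain q where q: "s = [:- w, 1:] * q"
      by (auto simp: poly_eq_0_iff_dvd)
    with less.prems(1) have "q \<noteq> 0" by auto
    then have deg: "degree q < degree s" unfolding q by (subst degree_mult_eq) auto
    show ?thesis
    proof (cases "w \<in> op_spectrum A")
      case True
      with w show ?thesis by blast
    next
      case False
      then have "op_invertible (A - op_scaleC w id_blinfun)" by (simp add: op_spectrum_def)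
      then have "\<not> op_invertible (op_poly q A)"
        using less.prems(2) op_invertible_compose
        unfolding q op_poly_mult[OF A] op_poly_linear[OF A] by blast
      from less.hyps[OF deg \<open>q \<noteq> 0\<close> this] show ?thesis by (auto simp: q)
    qed
  qed
qed

text \<open>
  With \<open>P = p(A)\<close> and \<open>m = \<parallel>P\<parallel>\<^sup>2\<close> one has \<open>\<parallel>(P\<^sup>* P - m) x\<parallel>\<^sup>2 \<le> 2 m (m \<parallel>x\<parallel>\<^sup>2 - \<parallel>P x\<parallel>\<^sup>2)\<close>, and the
  right-hand side is not bounded below by a multiple of \<open>\<parallel>x\<parallel>\<^sup>2\<close>.
\<close>

lemma op_poly_norm_singular:
  fixes A :: "'h::complex_hilbert_space \<Rightarrow>\<^sub>L 'h"
  assumes nontriv: "\<exists>x::'h. x \<noteq> 0" and sym: "op_symmetric A"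
  shows "\<not> op_invertible (op_poly (map_poly cnj p * p - [:complex_of_real ((norm (op_poly p A))\<^sup>2):]) A)"
    (is "\<not> op_invertible ?D")
proof
  assume "op_invertible ?D"
  note A = op_symmetric_bounded_ops[OF sym]
  define D where "D = ?D"
  have inv: "op_invertible D" unfolding D_def by fact
  define P where "P = op_poly p A"
  define Q where "Q = op_poly (map_poly cnj p) A"
  define m where "m = (norm P)\<^sup>2"
  have D: "D x = Q (P x) - m *\<^sub>R x" for x
    unfolding D_def
    by (simp only: op_poly_diff op_poly_mult op_poly_const A P_def[symmetric] Q_def[symmetric] m_def[symmetric])
       (simp add: minus_blinfun.rep_eq op_scaleC_of_real scaleR_blinfun.rep_eq scaleC_of_real)
  have adj: "cinner x (P y) = cinner (Q x) y" for x y
    unfolding P_def Q_def by (rule op_poly_adjoint[OF sym])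
  have "norm (Q x) \<le> norm P * norm x" for x
  proof (cases "Q x = 0")
    case False
    have "(norm (Q x))\<^sup>2 = Re (cinner x (P (Q x)))" by (simp add: adj cinner_self)
    also have "\<dots> \<le> norm x * norm (P (Q x))" by (rule Re_cinner_le)
    also have "\<dots> \<le> norm x * (norm P * norm (Q x))" by (intro mult_left_mono norm_blinfun) simp
    finally have "norm (Q x) * norm (Q x) \<le> (norm P * norm x) * norm (Q x)"
      by (simp add: power2_eq_square algebra_simps)
    then show ?thesis using False by simp
  qed simp
  then have "norm (Q (P x)) \<le> norm P * (norm P * norm x)" for x
    using norm_blinfun[of P x] by (meson mult_left_mono norm_ge_zero order_trans)
  then have QP: "norm (Q (P x)) \<le> m * norm x" for x
    by (simp add: m_def power2_eq_square mult.assoc)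
  have Dx: "(norm (D x))\<^sup>2 \<le> 2 * m * (m * (norm x)\<^sup>2 - (norm (P x))\<^sup>2)" for x
  proof -
    have "Re (cinner (Q (P x)) x) = (norm (P x))\<^sup>2"
      by (simp flip: adj add: cinner_self)
    then have "(norm (D x))\<^sup>2 = (norm (Q (P x)))\<^sup>2 - 2 * m * (norm (P x))\<^sup>2 + m\<^sup>2 * (norm x)\<^sup>2"
      unfolding D norm_diff_square by (simp add: cinner_simps m_def power_mult_distrib)
    also have "\<dots> \<le> (m * norm x)\<^sup>2 - 2 * m * (norm (P x))\<^sup>2 + m\<^sup>2 * (norm x)\<^sup>2"
      using power_mono[OF QP, of x 2] by simp
    finally show ?thesis by (simp add: power2_eq_square algebra_simps)
  qed
  define k where "k = (norm (op_inv D))\<^sup>2 + 1"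
  have k: "k > 0" unfolding k_def by (intro add_nonneg_pos) auto
  have low: "(norm x)\<^sup>2 \<le> k * (2 * m * (m * (norm x)\<^sup>2 - (norm (P x))\<^sup>2))" for x
  proof -
    have "norm x \<le> norm (op_inv D) * norm (D x)"
      using norm_blinfun[of "op_inv D" "D x"] by (simp add: op_inv_simps inv)
    then have "(norm x)\<^sup>2 \<le> (norm (op_inv D))\<^sup>2 * (norm (D x))\<^sup>2"
      by (metis norm_ge_zero power_mono power_mult_distrib)
    also have "\<dots> \<le> k * (norm (D x))\<^sup>2" by (intro mult_right_mono) (auto simp: k_def)
    also have "\<dots> \<le> k * (2 * m * (m * (norm x)\<^sup>2 - (norm (P x))\<^sup>2))"
      using k by (intro mult_left_mono Dx) simp
    finally show ?thesis .
  qed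
  from nontriv obtain x0 :: 'h where x0: "x0 \<noteq> 0" by blast
  have "m \<noteq> 0" using low[of x0] x0 by auto
  then have m: "m > 0" by (simp add: m_def)
  \<comment> \<open>Solving \<open>low\<close> for ||P x||^2 gives this factor. It is smaller than m
    = ||P||^2, which contradicts the definition of the norm.\<close>
  define \<mu> where "\<mu> = m - 1 / (2 * m * k)"
  have le: "(norm (P x))\<^sup>2 \<le> \<mu> * (norm x)\<^sup>2" for x
    using low[of x] m k by (simp add: \<mu>_def field_simps)
  have "0 \<le> \<mu> * (norm x0)\<^sup>2" using le[of x0] by (meson order_trans zero_le_power2)
  then have \<mu>: "\<mu> \<ge> 0" using x0 by (simp add: zero_le_mult_iff)
  have "norm P \<le> sqrt \<mu>"
  proof (rule norm_blinfun_bound)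
    show "norm (P x) \<le> sqrt \<mu> * norm x" for x
      by (rule power2_le_imp_le) (use le \<mu> in \<open>auto simp: power_mult_distrib\<close>)
  qed (use \<mu> in simp)
  then have "m \<le> \<mu>"
    unfolding m_def by (metis \<mu> norm_ge_zero power_mono real_sqrt_pow2)
  then show False using mult_pos_pos[OF k m] m k by (simp add: \<mu>_def)
qed

text \<open>For p = X the preceding lemma makes X^2 - ||A||^2 singular at A. This polynomial is
  never zero, so it has a root in the spectrum.\<close>

lemma op_spectrum_nonempty:
  fixes A :: "'h::complex_hilbert_space \<Rightarrow>\<^sub>L 'h"
  assumes "\<exists>x::'h. x \<noteq> 0" "op_symmetric A"
  shows "op_spectrum A \<noteq> {}"
proof -
  have "map_poly cnj [:0, 1:] * [:0, 1:] - [:c:] \<noteq> 0" for c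
    by (simp add: map_poly_pCons)
  then show ?thesis
    using op_poly_singular_root[OF op_symmetric_bounded_ops[OF assms(2)] _ op_poly_norm_singular[OF assms]]
    by blast
qed

text \<open>The polynomial s, the conjugate of p times p minus ||p(A)||^2, is singular at A and so
  has a spectral root w. Since w is real, the product at w is |p(w)|^2, hence |p(w)| =
  ||p(A)||.\<close>

lemma norm_op_poly_le_spectrum:
  fixes A :: "'h::complex_hilbert_space \<Rightarrow>\<^sub>L 'h"
  assumes nontriv: "\<exists>x::'h. x \<noteq> 0" and sym: "op_symmetric A"
  shows "\<exists>w\<in>op_spectrum A. norm (op_poly p A) \<le> cmod (poly p w)"
proof -
  note A = op_symmetric_bounded_ops[OF sym]
  define m where "m = (norm (op_poly p A))\<^sup>2"
  define s where "s = map_poly cnj p * p - [:complex_of_real m:]"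
  have sing: "\<not> op_invertible (op_poly s A)"
    unfolding s_def m_def using assms by (rule op_poly_norm_singular)
  show ?thesis
  proof (cases "s = 0")
    case False
    from op_poly_singular_root[OF A this sing] obtain w
      where w: "w \<in> op_spectrum A" "poly s w = 0" by blast
    have "cnj w = w" using op_spectrum_real[OF sym w(1)] by (metis complex_cnj_complex_of_real)
    then have "complex_of_real m = complex_of_real ((cmod (poly p w))\<^sup>2)"
      using w(2) by (simp add: s_def complex_norm_square mult.commute del: of_real_power)
    then have "norm (op_poly p A) = cmod (poly p w)"
      unfolding of_real_eq_iff m_def by (simp add: power2_eq_iff_nonneg)
    with w show ?thesis by auto
  next
    \<comment> \<open>Now the product of p with its conjugate is constant, which forces p to be
      constant; any point of the spectrum then serves.\<close>
    case True
    have "degree p = 0"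
    proof (cases "p = 0")
      case False
      have "map_poly cnj p * p = [:complex_of_real m:]" using True by (simp add: s_def)
      then have "degree (map_poly cnj p * p) = 0" by simp
      moreover have "map_poly cnj p \<noteq> 0" using False by (simp add: map_poly_eq_0_iff)
      ultimately show ?thesis using False by (simp add: degree_mult_eq)
    qed simp
    then obtain c where c: "p = [:c:]" by (rule degree_eq_zeroE)
    obtain w where w: "w \<in> op_spectrum A" using op_spectrum_nonempty[OF assms] by blast
    have "norm (op_poly p A) \<le> cmod c"
      by (rule norm_blinfun_bound) (simp_all add: c op_poly_const A norm_scaleC)
    with w show ?thesis by (intro bexI[of _ w]) (auto simp: c)
  qed
qed

section \<open>Functional calculus\<close>

text \<open>The property under the definite description in \<open>fun_calc\<close>. As a relation it
  can be shown to respect sums, products and limits before anything is known about existence or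
  uniqueness.\<close>

definition fun_calc_rel ::
    "('h::complex_hilbert_space \<Rightarrow>\<^sub>L 'h) \<Rightarrow> (complex \<Rightarrow> complex) \<Rightarrow> ('h \<Rightarrow>\<^sub>L 'h) \<Rightarrow> bool" where
  "fun_calc_rel A f S \<longleftrightarrow> (\<exists>p. uniform_limit (op_spectrum A) (\<lambda>n. poly (p n)) f sequentially
                              \<and> (\<lambda>n. op_poly (p n) A) \<longlonglongrightarrow> S)"

lemma fun_calc_rel_poly: "fun_calc_rel A (poly p) (op_poly p A)"
  unfolding fun_calc_rel_def by (intro exI[of _ "\<lambda>_. p"]) (auto intro: uniform_limit_const)

lemma fun_calc_rel_cong:
  assumes "fun_calc_rel A f S" "\<And>z. z \<in> op_spectrum A \<Longrightarrow> f z = g z"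
  shows "fun_calc_rel A g S"
proof -
  obtain p where p: "uniform_limit (op_spectrum A) (\<lambda>n. poly (p n)) f sequentially"
      "(\<lambda>n. op_poly (p n) A) \<longlonglongrightarrow> S"
    using assms(1) unfolding fun_calc_rel_def by blast
  have "uniform_limit (op_spectrum A) (\<lambda>n. poly (p n)) g sequentially"
    by (rule iffD1[OF uniform_limit_cong' p(1)]) (auto simp: assms(2))
  with p(2) show ?thesis unfolding fun_calc_rel_def by blast
qed

lemma fun_calc_rel_add:
  assumes "A \<in> bounded_ops" "fun_calc_rel A f S" "fun_calc_rel A g T"
  shows "fun_calc_rel A (\<lambda>z. f z + g z) (S + T)"
proof -
  obtain p q where
    "uniform_limit (op_spectrum A) (\<lambda>n. poly (p n)) f sequentially" "(\<lambda>n. op_poly (p n) A) \<longlonglongrightarrow> S"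
    "uniform_limit (op_spectrum A) (\<lambda>n. poly (q n)) g sequentially" "(\<lambda>n. op_poly (q n) A) \<longlonglongrightarrow> T"
    using assms unfolding fun_calc_rel_def by blast
  moreover have "poly (p n + q n) = (\<lambda>z. poly (p n) z + poly (q n) z)" for n
    by (rule ext) simp
  ultimately show ?thesis
    unfolding fun_calc_rel_def using assms(1)
    by (intro exI[of _ "\<lambda>n. p n + q n"]) (simp add: op_poly_add uniform_limit_add tendsto_add)
qed

text \<open>Products of uniform limits need bounded factors. Polynomials are bounded on a compact
  interval around the spectrum, and uniform limits inherit this.\<close>

lemma fun_calc_rel_bounded:
  assumes "op_symmetric A" "fun_calc_rel A f S"
  shows "bounded (f ` op_spectrum A)"
proof -
  obtain p where p: "uniform_limit (op_spectrum A) (\<lambda>n. poly (p n)) f sequentially"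
    using assms unfolding fun_calc_rel_def by blast
  define K where "K = complex_of_real ` {-norm A..norm A}"
  have sub: "op_spectrum A \<subseteq> K"
    unfolding K_def using abs_op_form_le[of A]
    by (intro op_spectrum_subset assms) (auto simp: abs_le_iff minus_le_iff)
  have "compact K"
    unfolding K_def by (intro compact_continuous_image continuous_intros) simp
  then have "bounded (poly (p n) ` K)" for n
    by (intro compact_imp_bounded compact_continuous_image continuous_intros)
  then have "bounded (poly (p n) ` op_spectrum A)" for n
    by (rule bounded_subset) (rule image_mono[OF sub])
  then show ?thesis
    by (intro uniform_limit_bounded[OF p]) auto
qed

lemma fun_calc_rel_mult:
  assumes "op_symmetric A" "fun_calc_rel A f S" "fun_calc_rel A g T"
  shows "fun_calc_rel A (\<lambda>z. f z * g z) (S o\<^sub>L T)"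
proof -
  obtain p q where
    p: "uniform_limit (op_spectrum A) (\<lambda>n. poly (p n)) f sequentially" "(\<lambda>n. op_poly (p n) A) \<longlonglongrightarrow> S" and
    q: "uniform_limit (op_spectrum A) (\<lambda>n. poly (q n)) g sequentially" "(\<lambda>n. op_poly (q n) A) \<longlonglongrightarrow> T"
    using assms unfolding fun_calc_rel_def by blast
  have "uniform_limit (op_spectrum A) (\<lambda>n z. poly (p n) z * poly (q n) z) (\<lambda>z. f z * g z) sequentially"
    using assms by (intro uniform_lim_mult p q fun_calc_rel_bounded)
  moreover have "poly (p n * q n) = (\<lambda>z. poly (p n) z * poly (q n) z)" for n
    by (rule ext) simp
  moreover have "(\<lambda>n. op_poly (p n) A o\<^sub>L op_poly (q n) A) \<longlonglongrightarrow> (S o\<^sub>L T)"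
    by (intro bounded_bilinear.tendsto[OF bounded_bilinear_blinfun_compose] p q)
  ultimately show ?thesis
    unfolding fun_calc_rel_def using op_symmetric_bounded_ops[OF assms(1)]
    by (intro exI[of _ "\<lambda>n. p n * q n"]) (simp add: op_poly_mult)
qed

lemma fun_calc_rel_scale:
  assumes "op_symmetric A" "fun_calc_rel A f S"
  shows "fun_calc_rel A (\<lambda>z. complex_of_real r * f z) (r *\<^sub>R S)"
proof -
  note A = op_symmetric_bounded_ops[OF assms(1)]
  have "fun_calc_rel A (\<lambda>z. poly [:complex_of_real r:] z * f z) (op_poly [:complex_of_real r:] A o\<^sub>L S)"
    using assms by (intro fun_calc_rel_mult fun_calc_rel_poly)
  moreover have "op_poly [:complex_of_real r:] A o\<^sub>L S = r *\<^sub>R S"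
    by (rule blinfun_eqI) (simp add: op_poly_const A scaleC_of_real scaleR_blinfun.rep_eq)
  ultimately show ?thesis by simp
qed

lemma fun_calc_rel_sum:
  fixes n :: nat
  assumes "A \<in> bounded_ops" "\<And>i. i < n \<Longrightarrow> fun_calc_rel A (f i) (S i)"
  shows "fun_calc_rel A (\<lambda>z. \<Sum>i<n. f i z) (\<Sum>i<n. S i)"
  using assms(2)
proof (induction n)
  case 0
  then show ?case using fun_calc_rel_poly[of A 0] by (simp add: fun_calc_rel_cong)
qed (simp add: fun_calc_rel_add assms(1))

lemma fun_calc_rel_norm_le:
  fixes A :: "'h::complex_hilbert_space \<Rightarrow>\<^sub>L 'h"
  assumes nontriv: "\<exists>x::'h. x \<noteq> 0" and sym: "op_symmetric A"
    and rel: "fun_calc_rel A f S" and le: "\<And>z. z \<in> op_spectrum A \<Longrightarrow> cmod (f z) \<le> c"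
  shows "norm S \<le> c"
proof (rule field_le_epsilon)
  fix e :: real assume e: "e > 0"
  obtain p where p: "uniform_limit (op_spectrum A) (\<lambda>n. poly (p n)) f sequentially"
      "(\<lambda>n. op_poly (p n) A) \<longlonglongrightarrow> S"
    using rel unfolding fun_calc_rel_def by blast
  have "\<forall>\<^sub>F n in sequentially. norm (op_poly (p n) A) \<le> c + e"
    using uniform_limitD[OF p(1) e]
  proof eventually_elim
    case (elim n)
    obtain w where w: "w \<in> op_spectrum A" "norm (op_poly (p n) A) \<le> cmod (poly (p n) w)"
      using norm_op_poly_le_spectrum[OF nontriv sym] by blast
    have "cmod (poly (p n) w) \<le> cmod (f w) + cmod (poly (p n) w - f w)" by (rule norm_triangle_sub)
    also have "\<dots> \<le> c + e"
      using elim w(1) le[OF w(1)] by (force simp: dist_norm)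
    finally show ?case using w(2) by simp
  qed
  then show "norm S \<le> c + e"
    by (intro tendsto_upperbound[OF tendsto_norm[OF p(2)]]) auto
qed

text \<open>The difference of two candidates represents the zero function, so its norm is at most
  0.\<close>

lemma fun_calc_rel_unique:
  fixes A :: "'h::complex_hilbert_space \<Rightarrow>\<^sub>L 'h"
  assumes "\<exists>x::'h. x \<noteq> 0" "op_symmetric A" "fun_calc_rel A f S" "fun_calc_rel A f T"
  shows "S = T"
proof -
  have "fun_calc_rel A (\<lambda>z. f z + complex_of_real (-1) * f z) (S + (-1) *\<^sub>R T)"
    using assms by (intro fun_calc_rel_add fun_calc_rel_scale op_symmetric_bounded_ops)
  from fun_calc_rel_norm_le[OF assms(1,2) this, of 0] show ?thesis by simp
qed

lemma fun_calc_eqI: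
  fixes A :: "'h::complex_hilbert_space \<Rightarrow>\<^sub>L 'h"
  assumes "\<exists>x::'h. x \<noteq> 0" "op_symmetric A" "fun_calc_rel A f S"
  shows "fun_calc f A = S"
  unfolding fun_calc_def
  by (rule the_equality)
     (use assms fun_calc_rel_unique[OF assms(1,2)] in \<open>auto simp: fun_calc_rel_def\<close>)

text \<open>A diagonal choice: for each n a single polynomial approximates \<open>f n\<close> on the
  spectrum and \<open>S n\<close> in norm, both within 1 / (n + 1), so one sequence serves both
  limits.\<close>

lemma fun_calc_rel_limit:
  assumes "\<And>n. fun_calc_rel A (f n) (S n)" "uniform_limit (op_spectrum A) f g sequentially" "S \<longlonglongrightarrow> T"
  shows "fun_calc_rel A g T"
proof -
  have "\<exists>q. (\<forall>z\<in>op_spectrum A. dist (poly q z) (f n z) < inverse (real (Suc n)))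
      \<and> dist (op_poly q A) (S n) < inverse (real (Suc n))" for n
  proof -
    obtain p where p: "uniform_limit (op_spectrum A) (\<lambda>k. poly (p k)) (f n) sequentially"
        "(\<lambda>k. op_poly (p k) A) \<longlonglongrightarrow> S n"
      using assms(1)[of n] unfolding fun_calc_rel_def by blast
    have "\<forall>\<^sub>F k in sequentially. (\<forall>z\<in>op_spectrum A. dist (poly (p k) z) (f n z) < inverse (real (Suc n)))
        \<and> dist (op_poly (p k) A) (S n) < inverse (real (Suc n))"
      by (intro eventually_conj uniform_limitD[OF p(1)] tendstoD[OF p(2)]) auto
    from eventually_happens'[OF sequentially_bot this] show ?thesis by (rule exE) (rule exI)
  qed
  then obtain q where q: "\<And>n z. z \<in> op_spectrum A \<Longrightarrow> dist (poly (q n) z) (f n z) < inverse (real (Suc n))"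
      "\<And>n. dist (op_poly (q n) A) (S n) < inverse (real (Suc n))"
    by metis
  have ev: "\<forall>\<^sub>F n in sequentially. inverse (real (Suc n)) < e" if "e > 0" for e
    using order_tendstoD(2)[OF LIMSEQ_inverse_real_of_nat that] .
  have "uniform_limit (op_spectrum A) (\<lambda>n. poly (q n)) g sequentially"
  proof (rule uniform_limitI)
    fix e :: real assume "e > 0"
    then have e: "e / 2 > 0" by simp
    show "\<forall>\<^sub>F n in sequentially. \<forall>z\<in>op_spectrum A. dist (poly (q n) z) (g z) < e"
      using ev[OF e] uniform_limitD[OF assms(2) e]
    proof eventually_elim
      case (elim n)
      show ?case
      proof
        fix z assume z: "z \<in> op_spectrum A"
        then have "dist (f n z) (g z) < e / 2" using elim by blast
        with q(1)[OF z, of n] elim(1) have "dist (poly (q n) z) (f n z) + dist (f n z) (g z) < e" by linarith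
        then show "dist (poly (q n) z) (g z) < e"
          by (rule le_less_trans[OF dist_triangle])
      qed
    qed
  qed
  moreover have "(\<lambda>n. op_poly (q n) A) \<longlonglongrightarrow> T"
  proof (rule Lim_transform[OF assms(3)])
    show "(\<lambda>n. op_poly (q n) A - S n) \<longlonglongrightarrow> 0"
    proof (rule Lim_null_comparison[OF _ LIMSEQ_inverse_real_of_nat])
      show "\<forall>\<^sub>F n in sequentially. norm (op_poly (q n) A - S n) \<le> inverse (real (Suc n))"
        using q(2) by (intro always_eventually) (simp add: dist_norm less_imp_le)
    qed
  qed
  ultimately show ?thesis unfolding fun_calc_rel_def by blast
qed

text \<open>Real coefficients matter because they make the approximating operators symmetric, a
  property that survives the limit.\<close>

lemma real_poly_approx:
  assumes "continuous_on {a..b} h" "e > 0"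
  obtains q where "map_poly cnj q = q"
    "\<And>x. x \<in> {a..b} \<Longrightarrow> cmod (poly q (complex_of_real x) - complex_of_real (h x)) < e"
proof -
  obtain g where g: "real_polynomial_function g" "\<And>x. x \<in> {a..b} \<Longrightarrow> \<bar>h x - g x\<bar> < e"
    using Stone_Weierstrass_real_polynomial_function[OF compact_Icc assms] by blast
  obtain c n where gs: "g = (\<lambda>x. \<Sum>i\<le>n. c i * x ^ i)"
    using g(1) unfolding real_polynomial_function_iff_sum by blast
  define q where "q = (\<Sum>i\<le>n. monom (complex_of_real (c i)) i)"
  have "poly q (complex_of_real x) = complex_of_real (g x)" for x
    by (simp add: q_def gs poly_sum poly_monom)
  then have "cmod (poly q (complex_of_real x) - complex_of_real (h x)) < e" if "x \<in> {a..b}" for x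
    using g(2)[OF that] by (simp flip: of_real_diff add: abs_minus_commute)
  moreover have "map_poly cnj q = q"
    by (rule poly_eqI) (simp add: q_def coeff_map_poly coeff_sum)
  ultimately show ?thesis using that by blast
qed

text \<open>By \<open>norm_op_poly_le_spectrum\<close>, polynomials that are uniformly close on the
  spectrum give operators close in norm, so completeness provides S. The commutation clause is what
  uniqueness of square roots will need.\<close>

lemma fun_calc_rel_exists:
  fixes A :: "'h::complex_hilbert_space \<Rightarrow>\<^sub>L 'h"
  assumes nontriv: "\<exists>x::'h. x \<noteq> 0" and sym: "op_symmetric A"
    and spec: "op_spectrum A \<subseteq> complex_of_real ` {a..b}" and cont: "continuous_on {a..b} h"
  obtains S where "fun_calc_rel A (\<lambda>z. complex_of_real (h (Re z))) S" "op_symmetric S"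
    "\<And>T. T \<in> bounded_ops \<Longrightarrow> T o\<^sub>L A = A o\<^sub>L T \<Longrightarrow> T o\<^sub>L S = S o\<^sub>L T"
proof -
  note A = op_symmetric_bounded_ops[OF sym]
  have "\<exists>q. map_poly cnj q = q \<and>
      (\<forall>x\<in>{a..b}. cmod (poly q (complex_of_real x) - complex_of_real (h x)) < inverse (real (Suc n)))" for n
    by (rule real_poly_approx[OF cont, of "inverse (real (Suc n))"]) auto
  then obtain q where q: "\<And>n. map_poly cnj (q n) = q n"
      "\<And>n x. x \<in> {a..b} \<Longrightarrow> cmod (poly (q n) (complex_of_real x) - complex_of_real (h x)) < inverse (real (Suc n))"
    by metis
  have q_spec: "cmod (poly (q n) z - complex_of_real (h (Re z))) < inverse (real (Suc n))"
    if z: "z \<in> op_spectrum A" for z n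
    using spec z q(2) by force
  have ev: "\<forall>\<^sub>F n in sequentially. inverse (real (Suc n)) < e" if "e > 0" for e
    using order_tendstoD(2)[OF LIMSEQ_inverse_real_of_nat that] .
  have unif: "uniform_limit (op_spectrum A) (\<lambda>n. poly (q n)) (\<lambda>z. complex_of_real (h (Re z))) sequentially"
  proof (rule uniform_limitI)
    fix e :: real assume "e > 0"
    from ev[OF this] show "\<forall>\<^sub>F n in sequentially. \<forall>z\<in>op_spectrum A. dist (poly (q n) z) (complex_of_real (h (Re z))) < e"
      by eventually_elim (auto simp: dist_norm intro: less_trans[OF q_spec])
  qed
  have diff: "norm (op_poly (q m) A - op_poly (q n) A) < inverse (real (Suc m)) + inverse (real (Suc n))" for m n
  proof -
    obtain w where w: "w \<in> op_spectrum A" "norm (op_poly (q m - q n) A) \<le> cmod (poly (q m - q n) w)"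
      using norm_op_poly_le_spectrum[OF nontriv sym] by blast
    have "cmod (poly (q m - q n) w) \<le> cmod (poly (q m) w - complex_of_real (h (Re w)))
        + cmod (poly (q n) w - complex_of_real (h (Re w)))"
      using norm_triangle_ineq4[of "poly (q m) w - complex_of_real (h (Re w))" "poly (q n) w - complex_of_real (h (Re w))"]
      by simp
    with q_spec[OF w(1), of m] q_spec[OF w(1), of n] w(2) show ?thesis by (simp add: op_poly_diff A)
  qed
  have "Cauchy (\<lambda>n. op_poly (q n) A)"
  proof (rule metric_CauchyI)
    fix e :: real assume "e > 0"
    then have "e / 2 > 0" by simp
    from ev[OF this] obtain M where M: "\<And>n. n \<ge> M \<Longrightarrow> inverse (real (Suc n)) < e / 2"
      by (auto simp: eventually_sequentially)
    show "\<exists>M. \<forall>m\<ge>M. \<forall>n\<ge>M. dist (op_poly (q m) A) (op_poly (q n) A) < e"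
    proof (intro exI[of _ M] allI impI)
      fix m n assume "M \<le> m" "M \<le> n"
      with M[of m] M[of n] diff[of m n] show "dist (op_poly (q m) A) (op_poly (q n) A) < e"
        unfolding dist_norm by linarith
    qed
  qed
  then obtain S where S: "(\<lambda>n. op_poly (q n) A) \<longlonglongrightarrow> S"
    by (auto simp: Cauchy_convergent_iff convergent_def)
  have Sx: "(\<lambda>n. op_poly (q n) A x) \<longlonglongrightarrow> S x" for x
    using blinfun.tendsto[OF S tendsto_const] .
  show ?thesis
  proof (rule that)
    show "fun_calc_rel A (\<lambda>z. complex_of_real (h (Re z))) S"
      unfolding fun_calc_rel_def using unif S by blast
    have "S \<in> bounded_ops" by (rule strong_limit_bounded_ops[OF Sx op_poly_bounded_ops[OF A]])
    moreover have "cinner x (S y) = cinner (S x) y" for x y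
    proof (rule LIMSEQ_unique)
      show "(\<lambda>n. cinner x (op_poly (q n) A y)) \<longlonglongrightarrow> cinner x (S y)" by (intro tendsto_intros Sx)
      show "(\<lambda>n. cinner x (op_poly (q n) A y)) \<longlonglongrightarrow> cinner (S x) y"
        unfolding op_poly_adjoint[OF sym] q(1) by (intro tendsto_intros Sx)
    qed
    ultimately show "op_symmetric S" by (simp add: op_symmetric_def)
    show "T o\<^sub>L S = S o\<^sub>L T" if T: "T \<in> bounded_ops" "T o\<^sub>L A = A o\<^sub>L T" for T
    proof (rule LIMSEQ_unique)
      note lim = bounded_bilinear.tendsto[OF bounded_bilinear_blinfun_compose]
      show "(\<lambda>n. T o\<^sub>L op_poly (q n) A) \<longlonglongrightarrow> (T o\<^sub>L S)" by (intro lim S tendsto_const)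
      show "(\<lambda>n. T o\<^sub>L op_poly (q n) A) \<longlonglongrightarrow> (S o\<^sub>L T)"
        unfolding op_poly_commute[OF A T] by (intro lim S tendsto_const)
    qed
  qed
qed

section \<open>Square roots\<close>

text \<open>For uniqueness, a positive root S commutes with A, hence with the root R obtained from
  the calculus. Then (R + S)(R - S) = 0, and R + S is coercive.\<close>

lemma op_sqrt_pos_inv_ops:
  fixes A :: "'h::complex_hilbert_space \<Rightarrow>\<^sub>L 'h"
  assumes nontriv: "\<exists>x::'h. x \<noteq> 0" and A: "A \<in> pos_inv_ops"
  shows "op_sqrt A \<in> pos_inv_ops" "op_sqrt A o\<^sub>L op_sqrt A = A"
proof -
  obtain d where d: "d > 0" "\<And>x. d * (norm x)\<^sup>2 \<le> op_form A x"
    using pos_inv_ops_coercive[OF A] by blast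
  have pos: "A \<in> pos_ops" and inv: "op_invertible A" using A by (auto simp: pos_inv_ops_def)
  have sym: "op_symmetric A" using pos by (rule pos_ops_symmetric)
  have spec: "op_spectrum A \<subseteq> complex_of_real ` {d..norm A}"
    by (intro op_spectrum_subset sym d op_form_le)
  \<comment> \<open>A fourth root is taken because its square is visibly positive: for symmetric Q
    the form of Q Q at x is ||Q x||^2.\<close>
  obtain Q where Q: "fun_calc_rel A (\<lambda>z. complex_of_real (sqrt (sqrt (Re z)))) Q" "op_symmetric Q"
    "\<And>T. T \<in> bounded_ops \<Longrightarrow> T o\<^sub>L A = A o\<^sub>L T \<Longrightarrow> T o\<^sub>L Q = Q o\<^sub>L T"
    by (rule fun_calc_rel_exists[OF nontriv sym spec, of "\<lambda>x. sqrt (sqrt x)"]) (auto intro!: continuous_intros)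
  define R where "R = Q o\<^sub>L Q"
  have R_sym: "op_symmetric R" using Q(2) by (auto simp: R_def op_symmetric_def)
  have R_pos: "R \<in> pos_ops"
    using R_sym by (auto simp: pos_ops_iff op_form_def R_def op_symmetricD[OF Q(2)] cinner_self)
  have "fun_calc_rel A (\<lambda>z. (complex_of_real (sqrt (sqrt (Re z))) * complex_of_real (sqrt (sqrt (Re z))))
      * (complex_of_real (sqrt (sqrt (Re z))) * complex_of_real (sqrt (sqrt (Re z))))) (R o\<^sub>L R)"
    unfolding R_def by (intro fun_calc_rel_mult sym Q)
  then have "fun_calc_rel A (poly [:0, 1:]) (R o\<^sub>L R)"
  proof (rule fun_calc_rel_cong)
    fix z assume "z \<in> op_spectrum A"
    then obtain x where x: "z = complex_of_real x" "x \<ge> 0" using spec d(1) by force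
    then show "(complex_of_real (sqrt (sqrt (Re z))) * complex_of_real (sqrt (sqrt (Re z))))
      * (complex_of_real (sqrt (sqrt (Re z))) * complex_of_real (sqrt (sqrt (Re z)))) = poly [:0, 1:] z"
      by (simp flip: of_real_mult)
  qed
  moreover have "op_poly [:0, 1:] A = A"
    using op_poly_linear[OF op_symmetric_bounded_ops[OF sym], of 0] op_scaleC_of_real[of 0 id_blinfun] by simp
  ultimately have RR: "R o\<^sub>L R = A"
    using fun_calc_rel_unique[OF nontriv sym] fun_calc_rel_poly by metis
  have R_inv: "op_invertible R"
    using op_invertible_commuting_factor[of R R] RR inv R_sym op_symmetric_bounded_ops by auto
  then have R: "R \<in> pos_inv_ops" using R_pos by (simp add: pos_inv_ops_def)
  then obtain r where r: "r > 0" "\<And>x. r * (norm x)\<^sup>2 \<le> op_form R x"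
    using pos_inv_ops_coercive by blast
  have uniq: "S = R" if S: "S \<in> pos_ops" "S o\<^sub>L S = A" for S
  proof -
    have "S o\<^sub>L A = A o\<^sub>L S" using S(2) by (metis compose_assoc)
    then have "S o\<^sub>L Q = Q o\<^sub>L S" using Q(3) S(1) pos_ops_bounded_ops by blast
    then have comm: "S o\<^sub>L R = R o\<^sub>L S" unfolding R_def by (metis compose_assoc)
    have "r * (norm x)\<^sup>2 \<le> op_form (R + S) x" for x
      using r(2)[of x] pos_opsD[OF S(1), of x] by (simp add: op_form_simps)
    then have inv: "op_invertible (R + S)"
      using r(1) R_sym pos_ops_symmetric[OF S(1)] by (intro coercive_invertible[of _ r]) auto
    have "(R + S) (R x - S x) = 0" for x
    proof -
      have "R (R x) = S (S x)" "S (R x) = R (S x)"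
        using RR S(2) comm by (metis blinfun_apply_blinfun_compose)+
      then show ?thesis by (simp add: plus_blinfun.rep_eq blinfun.diff_right)
    qed
    then have "R x - S x = 0" for x
      using op_inv_simps(5)[OF inv] blinfun.zero_right by metis
    then show ?thesis by (intro blinfun_eqI) simp
  qed
  have "op_sqrt A = R"
    unfolding op_sqrt_def using R_pos RR uniq by (intro the_equality) blast+
  then show "op_sqrt A \<in> pos_inv_ops" "op_sqrt A o\<^sub>L op_sqrt A = A"
    using R RR by auto
qed

section \<open>The parallel sum\<close>

definition par_form ::
    "('h::complex_hilbert_space \<Rightarrow>\<^sub>L 'h) \<Rightarrow> ('h \<Rightarrow>\<^sub>L 'h) \<Rightarrow> 'h \<Rightarrow> real" where
  "par_form A B x = (INF y. op_form A y + op_form B (x - y))"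

lemma par_form_bdd_below:
  assumes "A \<in> pos_ops" "B \<in> pos_ops"
  shows "bdd_below (range (\<lambda>y. op_form A y + op_form B (x - y)))"
  using pos_opsD[OF assms(1)] pos_opsD[OF assms(2)] by (intro bdd_belowI[of _ 0]) auto

lemma par_form_le:
  assumes "A \<in> pos_ops" "B \<in> pos_ops"
  shows "par_form A B x \<le> op_form A y + op_form B (x - y)"
  unfolding par_form_def by (intro cINF_lower par_form_bdd_below assms) simp

lemma par_form_greatest:
  "(\<And>y. c \<le> op_form A y + op_form B (x - y)) \<Longrightarrow> c \<le> par_form A B x"
  unfolding par_form_def by (intro cINF_greatest) auto

lemma par_form_mono:
  assumes "A \<in> pos_ops" "B \<in> pos_ops" "\<And>y. op_form A y \<le> op_form C y" "\<And>y. op_form B y \<le> op_form D y"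
  shows "par_form A B x \<le> par_form C D x"
  by (rule par_form_greatest, rule order_trans[OF par_form_le]) (use assms add_mono in blast)+

lemma par_form_commute_le:
  assumes "A \<in> pos_ops" "B \<in> pos_ops"
  shows "par_form A B x \<le> par_form B A x"
proof (rule par_form_greatest)
  show "par_form A B x \<le> op_form B y + op_form A (x - y)" for y
    using par_form_le[OF assms, of x "x - y"] by simp
qed

lemma par_form_commute: "A \<in> pos_ops \<Longrightarrow> B \<in> pos_ops \<Longrightarrow> par_form A B x = par_form B A x"
  by (intro antisym par_form_commute_le)

text \<open>Monotonicity bounds the values from below by the limit. For the upper bound a single
  nearly optimal y for A and B is used as competitor for all n.\<close>

lemma par_form_tendsto:
  assumes pos: "\<And>n. X n \<in> pos_ops" "\<And>n. Y n \<in> pos_ops" "A \<in> pos_ops" "B \<in> pos_ops"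
    and ge: "\<And>n x. op_form A x \<le> op_form (X n) x" "\<And>n x. op_form B x \<le> op_form (Y n) x"
    and lim: "\<And>x. (\<lambda>n. op_form (X n) x) \<longlonglongrightarrow> op_form A x" "\<And>x. (\<lambda>n. op_form (Y n) x) \<longlonglongrightarrow> op_form B x"
  shows "(\<lambda>n. par_form (X n) (Y n) x) \<longlonglongrightarrow> par_form A B x"
proof (rule order_tendstoI)
  fix a assume a: "a < par_form A B x"
  have "par_form A B x \<le> par_form (X n) (Y n) x" for n by (intro par_form_mono pos ge)
  with a show "\<forall>\<^sub>F n in sequentially. a < par_form (X n) (Y n) x"
    by (intro always_eventually allI) (rule less_le_trans)
next
  fix a assume "par_form A B x < a"
  then obtain y where y: "op_form A y + op_form B (x - y) < a"
    unfolding par_form_def using par_form_bdd_below[OF pos(3,4)] by (auto simp: cINF_less_iff)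
  have "(\<lambda>n. op_form (X n) y + op_form (Y n) (x - y)) \<longlonglongrightarrow> op_form A y + op_form B (x - y)"
    by (intro tendsto_add lim)
  from order_tendstoD(2)[OF this y] show "\<forall>\<^sub>F n in sequentially. par_form (X n) (Y n) x < a"
    by eventually_elim (rule le_less_trans[OF par_form_le[OF pos(1,2)]])
qed

lemma op_form_diff:
  assumes "op_symmetric A"
  shows "op_form A (x - y) = op_form A x - 2 * Re (cinner x (A y)) + op_form A y"
  using op_form_add[OF assms, of x "- y"] op_form_scaleR[of A "-1" y]
  by (simp add: blinfun.minus_right cinner_minus_right)

text \<open>The infimum is attained at \<open>y\<^sub>0 = (A + B)\<^sup>-\<^sup>1 B x\<close>.\<close>

lemma par_form_invertible:
  assumes A: "A \<in> pos_ops" and B: "B \<in> pos_ops" and inv: "op_invertible (A + B)"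
  shows "par_form A B x = op_form (B - (B o\<^sub>L op_inv (A + B) o\<^sub>L B)) x"
proof -
  note symA = pos_ops_symmetric[OF A] and symB = pos_ops_symmetric[OF B]
  define y0 where "y0 = op_inv (A + B) (B x)"
  have y0: "A y0 + B y0 = B x"
    using op_inv_simps(4)[OF inv, of "B x"] by (simp add: y0_def plus_blinfun.rep_eq)
  have rhs: "op_form (B - (B o\<^sub>L op_inv (A + B) o\<^sub>L B)) x = op_form B x - Re (cinner x (B y0))"
    by (simp add: op_form_def minus_blinfun.rep_eq cinner_diff_right y0_def)
  \<comment> \<open>The equation for \<open>y0\<close> cancels all terms linear in w, so deviating
    from \<open>y0\<close> by w costs exactly the energy of w.\<close>
  have energy: "op_form A (y0 + w) + op_form B (x - (y0 + w))
      = op_form B x - Re (cinner x (B y0)) + (op_form A w + op_form B w)" for w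
  proof -
    have "Re (cinner w (A y0)) + Re (cinner w (B y0)) = Re (cinner x (B w))"
    proof -
      have "cinner w (A y0) + cinner w (B y0) = cinner w (B x)"
        unfolding y0[symmetric] by (simp add: cinner_add_right)
      then show ?thesis
        using Re_cinner_commute[of "B w" x] by (simp add: op_symmetricD[OF symB] flip: plus_complex.sel(1))
    qed
    moreover have "op_form A y0 + op_form B y0 = Re (cinner x (B y0))"
    proof -
      have "op_form A y0 + op_form B y0 = Re (cinner y0 (B x))"
        unfolding y0[symmetric] by (simp add: op_form_def cinner_add_right)
      then show ?thesis
        using Re_cinner_commute[of "B y0" x] by (simp add: op_symmetricD[OF symB])
    qed
    ultimately show ?thesis
      using Re_cinner_commute[of "A y0" w] Re_cinner_commute[of "B y0" w]
      by (simp add: op_form_add[OF symA] op_form_add[OF symB] op_form_diff[OF symB] blinfun.add_right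
          cinner_add_right op_symmetricD[OF symA] op_symmetricD[OF symB])
  qed
  show ?thesis
  proof (rule antisym)
    show "par_form A B x \<le> op_form (B - (B o\<^sub>L op_inv (A + B) o\<^sub>L B)) x"
      using par_form_le[OF A B, of x y0] energy[of 0] unfolding rhs by (simp add: op_form_simps)
    show "op_form (B - (B o\<^sub>L op_inv (A + B) o\<^sub>L B)) x \<le> par_form A B x"
    proof (rule par_form_greatest)
      show "op_form (B - (B o\<^sub>L op_inv (A + B) o\<^sub>L B)) x \<le> op_form A y + op_form B (x - y)" for y
        using energy[of "y - y0"] pos_opsD[OF A, of "y - y0"] pos_opsD[OF B, of "y - y0"]
        unfolding rhs by simp
    qed
  qed
qed

lemma par_form_nonneg: "A \<in> pos_ops \<Longrightarrow> B \<in> pos_ops \<Longrightarrow> 0 \<le> par_form A B x"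
  by (intro par_form_greatest add_nonneg_nonneg pos_opsD)

lemma par_form_invertible_pos_ops:
  assumes "A \<in> pos_ops" "B \<in> pos_ops" "op_invertible (A + B)"
  shows "B - (B o\<^sub>L op_inv (A + B) o\<^sub>L B) \<in> pos_ops"
proof -
  have "op_symmetric (op_inv (A + B))"
    using assms by (intro op_symmetric_op_inv pos_ops_symmetric) auto
  then have "op_symmetric (B - (B o\<^sub>L op_inv (A + B) o\<^sub>L B))"
    using assms pos_ops_symmetric by (intro op_symmetric_closed op_symmetric_conj) auto
  then show ?thesis
    using par_form_nonneg[OF assms(1,2)] par_form_invertible[OF assms] by (simp add: pos_ops_iff)
qed

text \<open>Adding multiples of the identity that shrink to 0 makes the sum invertible. The
  resulting operators decrease, so they have a strong limit, and its form is the limit of their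
  forms.\<close>

lemma par_form_pos_op_exists:
  fixes A B :: "'h::complex_hilbert_space \<Rightarrow>\<^sub>L 'h"
  assumes A: "A \<in> pos_ops" and B: "B \<in> pos_ops"
  shows "\<exists>P\<in>pos_ops. \<forall>x. op_form P x = par_form A B x"
proof -
  define \<epsilon> where "\<epsilon> n = inverse (real (Suc n))" for n
  define U where "U n = A + \<epsilon> n *\<^sub>R id_blinfun" for n
  define V where "V n = B + \<epsilon> n *\<^sub>R id_blinfun" for n
  have \<epsilon>: "\<epsilon> n > 0" "\<epsilon> (Suc n) \<le> \<epsilon> n" for n by (auto simp: \<epsilon>_def field_simps)
  have \<epsilon>_lim: "\<epsilon> \<longlonglongrightarrow> 0" unfolding \<epsilon>_def by (rule LIMSEQ_inverse_real_of_nat)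
  have pos: "U n \<in> pos_ops" "V n \<in> pos_ops" for n
    unfolding U_def V_def using A B \<epsilon>(1)[of n] by auto
  have form: "op_form (U n) x = op_form A x + \<epsilon> n * (norm x)\<^sup>2"
    "op_form (V n) x = op_form B x + \<epsilon> n * (norm x)\<^sup>2" for n x
    by (simp_all add: U_def V_def op_form_simps)
  have inv: "op_invertible (U n + V n)" for n
  proof (rule coercive_invertible[OF _ \<epsilon>(1)[of n]])
    show "op_symmetric (U n + V n)" using pos by (intro pos_ops_symmetric) auto
    show "\<epsilon> n * (norm x)\<^sup>2 \<le> op_form (U n + V n) x" for x
      using pos_opsD[OF A, of x] pos_opsD[OF pos(2)[of n], of x] by (simp add: op_form_simps form(1))
  qed
  define X where "X n = V n - (V n o\<^sub>L op_inv (U n + V n) o\<^sub>L V n)" for n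
  have X: "X n \<in> pos_ops" "op_form (X n) x = par_form (U n) (V n) x" for n x
    unfolding X_def using par_form_invertible_pos_ops[OF pos inv] par_form_invertible[OF pos inv] by auto
  have "X (Suc n) \<preceq> X n" for n
    using mult_right_mono[OF \<epsilon>(2)]
    by (auto simp: loewner_le_iff pos_ops_symmetric X form intro!: par_form_mono pos)
  then obtain P where P: "P \<in> pos_ops" "X \<down> P" using pos_ops_decreasing_limit[of X] X(1) by blast
  have "op_form P x = par_form A B x" for x
  proof (rule LIMSEQ_unique)
    show "(\<lambda>n. op_form (X n) x) \<longlonglongrightarrow> op_form P x" by (rule decreases_to_form[OF P(2)])
    have "(\<lambda>n. op_form (U n) y) \<longlonglongrightarrow> op_form A y" "(\<lambda>n. op_form (V n) y) \<longlonglongrightarrow> op_form B y" for y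
      unfolding form using tendsto_add[OF tendsto_const tendsto_mult[OF \<epsilon>_lim tendsto_const[of "(norm y)\<^sup>2"]]]
      by simp_all
    then show "(\<lambda>n. op_form (X n) x) \<longlonglongrightarrow> par_form A B x"
      unfolding X using \<epsilon>(1) by (intro par_form_tendsto pos A B) (auto simp: form less_imp_le)
  qed
  with P show ?thesis by blast
qed

definition par_sum ::
    "('h::complex_hilbert_space \<Rightarrow>\<^sub>L 'h) \<Rightarrow> ('h \<Rightarrow>\<^sub>L 'h) \<Rightarrow> ('h \<Rightarrow>\<^sub>L 'h)" where
  "par_sum A B = (SOME P. P \<in> pos_ops \<and> (\<forall>x. op_form P x = par_form A B x))"

lemma
  assumes "A \<in> pos_ops" "B \<in> pos_ops"
  shows par_sum_pos_ops: "par_sum A B \<in> pos_ops"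
    and op_form_par_sum: "op_form (par_sum A B) x = par_form A B x"
  using someI_ex[of "\<lambda>P. P \<in> pos_ops \<and> (\<forall>x. op_form P x = par_form A B x)"]
    par_form_pos_op_exists[OF assms] unfolding par_sum_def by blast+

lemma par_sum_eqI:
  assumes "A \<in> pos_ops" "B \<in> pos_ops" "P \<in> pos_ops" "\<And>x. op_form P x = par_form A B x"
  shows "par_sum A B = P"
  by (rule pos_ops_eqI) (use assms par_sum_pos_ops op_form_par_sum in auto)

lemma par_sum_commute: "A \<in> pos_ops \<Longrightarrow> B \<in> pos_ops \<Longrightarrow> par_sum A B = par_sum B A"
  by (rule par_sum_eqI) (simp_all add: par_sum_pos_ops op_form_par_sum par_form_commute)

text \<open>The infimum is tested at y = x and at y = 0.\<close>

lemma par_sum_le: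
  assumes "A \<in> pos_ops" "B \<in> pos_ops"
  shows "op_form (par_sum A B) x \<le> op_form A x" "op_form (par_sum A B) x \<le> op_form B x"
  using par_form_le[OF assms, of x x] par_form_le[OF assms, of x 0] assms
  by (simp_all add: op_form_par_sum op_form_simps)

lemma norm_par_sum_le:
  assumes "A \<in> pos_ops" "B \<in> pos_ops"
  shows "norm (par_sum A B) \<le> norm A" "norm (par_sum A B) \<le> norm B"
proof -
  have "par_sum A B \<preceq> A" "par_sum A B \<preceq> B"
    using par_sum_le[OF assms] assms par_sum_pos_ops[OF assms]
    by (simp_all add: loewner_le_iff pos_ops_symmetric)
  then show "norm (par_sum A B) \<le> norm A" "norm (par_sum A B) \<le> norm B"
    using par_sum_pos_ops[OF assms] loewner_le_norm by blast+
qed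

text \<open>On the right only competitors of the form C y enter the infimum for A and B at C x, so
  that infimum can only be larger.\<close>

lemma par_sum_conj_le:
  assumes "A \<in> pos_ops" "B \<in> pos_ops" "op_symmetric C"
  shows "op_form (par_sum A B) (C x) \<le> op_form (par_sum (C o\<^sub>L A o\<^sub>L C) (C o\<^sub>L B o\<^sub>L C)) x"
proof -
  have "par_form A B (C x) \<le> par_form (C o\<^sub>L A o\<^sub>L C) (C o\<^sub>L B o\<^sub>L C) x"
  proof (rule par_form_greatest)
    show "par_form A B (C x) \<le> op_form (C o\<^sub>L A o\<^sub>L C) y + op_form (C o\<^sub>L B o\<^sub>L C) (x - y)" for y
      using par_form_le[OF assms(1,2), of "C x" "C y"]
      by (simp add: op_form_conj[OF assms(3)] blinfun.diff_right)
  qed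
  then show ?thesis
    using assms by (simp add: op_form_par_sum pos_ops_conj)
qed

text \<open>If C is invertible, every competitor y is C applied to \<open>op_inv C y\<close>, so the
  two infima run over the same values.\<close>

lemma par_sum_conj_eq:
  assumes A: "A \<in> pos_ops" and B: "B \<in> pos_ops" and C: "op_symmetric C" "op_invertible C"
  shows "par_sum (C o\<^sub>L A o\<^sub>L C) (C o\<^sub>L B o\<^sub>L C) = C o\<^sub>L par_sum A B o\<^sub>L C"
proof (rule pos_ops_eqI)
  show "par_sum (C o\<^sub>L A o\<^sub>L C) (C o\<^sub>L B o\<^sub>L C) \<in> pos_ops" "C o\<^sub>L par_sum A B o\<^sub>L C \<in> pos_ops"
    using assms by (auto intro: par_sum_pos_ops pos_ops_conj)
  fix x
  have "par_form (C o\<^sub>L A o\<^sub>L C) (C o\<^sub>L B o\<^sub>L C) x \<le> par_form A B (C x)"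
  proof (rule par_form_greatest)
    show "par_form (C o\<^sub>L A o\<^sub>L C) (C o\<^sub>L B o\<^sub>L C) x \<le> op_form A y + op_form B (C x - y)" for y
      using par_form_le[OF pos_ops_conj[OF A C(1)] pos_ops_conj[OF B C(1)], of x "op_inv C y"]
      by (simp add: op_form_conj[OF C(1)] blinfun.diff_right op_inv_simps[OF C(2)])
  qed
  with par_sum_conj_le[OF A B C(1), of x] A B C
  show "op_form (par_sum (C o\<^sub>L A o\<^sub>L C) (C o\<^sub>L B o\<^sub>L C)) x = op_form (C o\<^sub>L par_sum A B o\<^sub>L C) x"
    by (simp add: op_form_conj op_form_par_sum pos_ops_conj)
qed

text \<open>This is a b C / (a + b C) with the denominator multiplied out; it holds because C
  commutes with a + b C. In this form it can be compared with the functional calculus by cancelling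
  an invertible factor.\<close>

lemma par_sum_scaled_id:
  assumes C: "C \<in> pos_ops" and ab: "a > 0" "b > 0"
  shows "op_invertible (a *\<^sub>R id_blinfun + b *\<^sub>R C)"
    and "par_sum (a *\<^sub>R id_blinfun) (b *\<^sub>R C) o\<^sub>L (a *\<^sub>R id_blinfun + b *\<^sub>R C) = (a * b) *\<^sub>R C"
proof -
  let ?T = "a *\<^sub>R id_blinfun + b *\<^sub>R C"
  have pos: "a *\<^sub>R id_blinfun \<in> pos_ops" "b *\<^sub>R C \<in> pos_ops" using C ab by auto
  show inv: "op_invertible ?T"
  proof (rule coercive_invertible[OF _ ab(1)])
    show "op_symmetric ?T" using pos by (intro pos_ops_symmetric) auto
    show "a * (norm x)\<^sup>2 \<le> op_form ?T x" for x
      using pos_opsD[OF C, of x] ab by (simp add: op_form_simps)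
  qed
  have P: "par_sum (a *\<^sub>R id_blinfun) (b *\<^sub>R C) = b *\<^sub>R C - (b *\<^sub>R C o\<^sub>L op_inv ?T o\<^sub>L b *\<^sub>R C)"
    by (rule par_sum_eqI[OF pos par_form_invertible_pos_ops[OF pos inv] par_form_invertible[OF pos inv, symmetric]])
  show "par_sum (a *\<^sub>R id_blinfun) (b *\<^sub>R C) o\<^sub>L ?T = (a * b) *\<^sub>R C"
  proof (rule blinfun_eqI)
    fix x
    have "(b *\<^sub>R C) (?T x) = ?T ((b *\<^sub>R C) x)"
      by (simp add: plus_blinfun.rep_eq scaleR_blinfun.rep_eq blinfun.add_right blinfun.scaleR_right
          scaleR_add_right mult.commute)
    then have "op_inv ?T ((b *\<^sub>R C) (?T x)) = (b *\<^sub>R C) x"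
      by (simp only: op_inv_simps(5)[OF inv])
    then show "(par_sum (a *\<^sub>R id_blinfun) (b *\<^sub>R C) o\<^sub>L ?T) x = ((a * b) *\<^sub>R C) x"
      unfolding P
      by (simp add: minus_blinfun.rep_eq del: scaleR_blinfun.rep_eq)
         (simp add: plus_blinfun.rep_eq scaleR_blinfun.rep_eq blinfun.add_right blinfun.scaleR_right
          scaleR_add_right mult.commute)
  qed
qed

lemma par_sum_id_id:
  assumes ab: "a > 0" "b > 0"
  shows "par_sum (a *\<^sub>R id_blinfun) (b *\<^sub>R id_blinfun) = (a * b / (a + b)) *\<^sub>R (id_blinfun :: 'h::complex_hilbert_space \<Rightarrow>\<^sub>L 'h)"
proof (rule blinfun_eqI)
  fix x :: 'h
  let ?P = "par_sum (a *\<^sub>R id_blinfun) (b *\<^sub>R (id_blinfun :: 'h \<Rightarrow>\<^sub>L 'h))"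
  have "(?P o\<^sub>L (a *\<^sub>R id_blinfun + b *\<^sub>R id_blinfun)) x = ((a * b) *\<^sub>R id_blinfun) x"
    using par_sum_scaled_id(2)[OF pos_ops_closed(2) ab] by metis
  then have "(a + b) *\<^sub>R ?P x = (a * b) *\<^sub>R x"
    by (simp add: plus_blinfun.rep_eq scaleR_blinfun.rep_eq blinfun.add_right blinfun.scaleR_right
        scaleR_add_left)
  then have "(1 / (a + b)) *\<^sub>R (a + b) *\<^sub>R ?P x = (1 / (a + b)) *\<^sub>R (a * b) *\<^sub>R x" by (rule arg_cong)
  then show "?P x = ((a * b / (a + b)) *\<^sub>R id_blinfun) x"
    using ab by (simp add: scaleR_blinfun.rep_eq)
qed

text \<open>The operator S produced by the calculus and the parallel sum have the same product with
  the invertible a + b C, hence coincide. For S that product represents a polynomial, so uniqueness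
  determines it.\<close>

lemma fun_calc_rel_par_sum:
  fixes C :: "'h::complex_hilbert_space \<Rightarrow>\<^sub>L 'h"
  assumes nontriv: "\<exists>x::'h. x \<noteq> 0" and C: "C \<in> pos_inv_ops" and ab: "a > 0" "b > 0"
  shows "fun_calc_rel C (\<lambda>z. of_real (a * b) * z / (of_real a + of_real b * z))
           (par_sum (a *\<^sub>R id_blinfun) (b *\<^sub>R C))"
proof -
  obtain d where d: "d > 0" "\<And>x. d * (norm x)\<^sup>2 \<le> op_form C x"
    using pos_inv_ops_coercive[OF C] by blast
  have pos: "C \<in> pos_ops" using C by (simp add: pos_inv_ops_def)
  have sym: "op_symmetric C" using pos by (rule pos_ops_symmetric)
  note bdd = op_symmetric_bounded_ops[OF sym]
  have spec: "op_spectrum C \<subseteq> complex_of_real ` {d..norm C}"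
    by (intro op_spectrum_subset sym d op_form_le)
  have denom: "a + b * x > 0" if "x \<ge> d" for x
    using that d(1) ab by (intro add_pos_pos mult_pos_pos) auto
  have "continuous_on {d..norm C} (\<lambda>x. a * b * x / (a + b * x))"
    using denom by (intro continuous_intros) (metis atLeastAtMost_iff denom less_irrefl)
  then obtain S where S: "fun_calc_rel C (\<lambda>z. complex_of_real (a * b * Re z / (a + b * Re z))) S"
    by (rule fun_calc_rel_exists[OF nontriv sym spec])
  let ?T = "a *\<^sub>R id_blinfun + b *\<^sub>R C"
  have T: "op_poly [:complex_of_real a, complex_of_real b:] C = ?T"
    by (rule blinfun_eqI)
       (simp add: op_poly_pCons_apply bdd plus_blinfun.rep_eq scaleR_blinfun.rep_eq scaleC_of_real blinfun.scaleR_right)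
  have "fun_calc_rel C (\<lambda>z. complex_of_real (a * b * Re z / (a + b * Re z))
      * poly [:complex_of_real a, complex_of_real b:] z) (S o\<^sub>L ?T)"
    unfolding T[symmetric] by (intro fun_calc_rel_mult sym S fun_calc_rel_poly)
  then have "fun_calc_rel C (poly [:0, complex_of_real (a * b):]) (S o\<^sub>L ?T)"
  proof (rule fun_calc_rel_cong)
    fix z assume "z \<in> op_spectrum C"
    then obtain x where x: "z = complex_of_real x" "x \<ge> d" using spec by force
    have "a * b * x / (a + b * x) * (a + x * b) = x * (a * b)"
      using denom[OF x(2)] by (simp add: mult.commute)
    then show "complex_of_real (a * b * Re z / (a + b * Re z)) * poly [:complex_of_real a, complex_of_real b:] z
        = poly [:0, complex_of_real (a * b):] z"
      by (simp add: x(1) flip: of_real_mult of_real_add of_real_divide)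
  qed
  moreover have "op_poly [:0, complex_of_real (a * b):] C = (a * b) *\<^sub>R C"
    by (rule blinfun_eqI)
       (simp add: op_poly_pCons_apply bdd scaleR_blinfun.rep_eq scaleC_of_real blinfun.scaleR_right flip: of_real_mult)
  ultimately have ST: "S o\<^sub>L ?T = (a * b) *\<^sub>R C"
    using fun_calc_rel_unique[OF nontriv sym] fun_calc_rel_poly by metis
  note inv = par_sum_scaled_id(1)[OF pos ab]
  have "S o\<^sub>L ?T o\<^sub>L op_inv ?T = par_sum (a *\<^sub>R id_blinfun) (b *\<^sub>R C) o\<^sub>L ?T o\<^sub>L op_inv ?T"
    by (simp only: ST par_sum_scaled_id(2)[OF pos ab])
  then have "S = par_sum (a *\<^sub>R id_blinfun) (b *\<^sub>R C)"
    by (simp only: compose_assoc op_inv_simps(2)[OF inv] id_compose)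
  moreover have "fun_calc_rel C (\<lambda>z. of_real (a * b) * z / (of_real a + of_real b * z)) S"
    using S
  proof (rule fun_calc_rel_cong)
    fix z assume "z \<in> op_spectrum C"
    then obtain x where x: "z = complex_of_real x" using spec by force
    show "complex_of_real (a * b * Re z / (a + b * Re z)) = of_real (a * b) * z / (of_real a + of_real b * z)"
      by (simp add: x)
  qed
  ultimately show ?thesis by simp
qed

section \<open>The representing functions\<close>

definition wt :: "real \<Rightarrow> nat \<Rightarrow> real" where
  "wt d n = d ^ (2 * n + 1)"

definition molnar_term :: "real \<Rightarrow> nat \<Rightarrow> real \<Rightarrow> real" where
  "molnar_term d n x = wt d n * x / (1 + (wt d n)\<^sup>2 * x) + wt d n * x / ((wt d n)\<^sup>2 + x)"

definition molnar_const :: "real \<Rightarrow> real" where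
  "molnar_const d = (\<Sum>n. molnar_term d n 1)"

definition molnar_cterm :: "real \<Rightarrow> nat \<Rightarrow> complex \<Rightarrow> complex" where
  "molnar_cterm d n z = of_real (wt d n) * z / (1 + of_real ((wt d n)\<^sup>2) * z)
     + of_real (wt d n) * z / (of_real ((wt d n)\<^sup>2) + z)"

definition molnar_fun :: "real \<Rightarrow> complex \<Rightarrow> complex" where
  "molnar_fun d z = of_real (1 / molnar_const d) * (\<Sum>n. molnar_cterm d n z)"

section \<open>Convergence of the series defining the representing functions\<close>

lemma wt_pos: "d > 1 \<Longrightarrow> wt d n > 0"
  by (simp add: wt_def)

lemma inverse_wt_sums: "d > 1 \<Longrightarrow> (\<lambda>n. 1 / wt d n) sums (d / (d\<^sup>2 - 1))"
proof -
  assume d: "d > 1"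
  have "norm (1 / d\<^sup>2) < 1" using d by (simp add: power_gt1 one_less_power)
  from sums_mult[OF geometric_sums[OF this], of "1 / d"]
  have "(\<lambda>n. 1 / d * (1 / d\<^sup>2) ^ n) sums (1 / d * (1 / (1 - 1 / d\<^sup>2)))" .
  moreover have "1 / d * (1 / d\<^sup>2) ^ n = 1 / wt d n" for n
    by (simp add: wt_def power_mult power_divide)
  moreover have "1 / d * (1 / (1 - 1 / d\<^sup>2)) = d / (d\<^sup>2 - 1)"
    using d by (simp add: field_simps power2_eq_square)
  ultimately show ?thesis by simp
qed

lemma summable_inverse_wt: "d > 1 \<Longrightarrow> summable (\<lambda>n. 1 / wt d n)"
  using inverse_wt_sums sums_summable by blast

lemma wt_at_top:
  assumes "d > 1"
  shows "filterlim (\<lambda>n. (wt d n)\<^sup>2) at_top sequentially"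
proof -
  have "filterlim (wt d) at_infinity sequentially"
  proof (rule filterlim_inverse_at_infinity[THEN filterlim_compose, of "\<lambda>n. 1 / wt d n", simplified])
    show "filterlim (\<lambda>n. 1 / wt d n) (at 0) sequentially"
      using wt_pos[OF assms] summable_LIMSEQ_zero[OF summable_inverse_wt[OF assms]]
      by (auto simp: filterlim_at less_imp_neq[symmetric])
  qed
  then have "filterlim (wt d) at_top sequentially"
    by (rule filterlim_at_infinity_imp_filterlim_at_top) (use wt_pos[OF assms] in auto)
  then show ?thesis by (intro filterlim_pow_at_top) auto
qed

text \<open>With s = \<open>wt d n\<close>, the size conditions say that |s^2 z| is at least 2 and
  that s^2 is at least 2 |z|. Each denominator is then at least half its larger summand, so both
  quotients are of order 1 / s.\<close>

lemma molnar_cterm_norm_le: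
  assumes d: "d > 1" and z: "0 < r" "r \<le> cmod z" "cmod z \<le> R"
    and n: "2 / r \<le> (wt d n)\<^sup>2" "2 * R \<le> (wt d n)\<^sup>2"
  shows "cmod (molnar_cterm d n z) \<le> (2 + 2 * R) * (1 / wt d n)"
proof -
  define s where "s = wt d n"
  have s: "s > 0" "2 \<le> s\<^sup>2 * cmod z" "2 * cmod z \<le> s\<^sup>2"
  proof -
    show "s > 0" unfolding s_def using d by (rule wt_pos)
    have "2 = 2 / r * r" using z by simp
    also have "\<dots> \<le> s\<^sup>2 * cmod z" unfolding s_def using n z by (intro mult_mono) auto
    finally show "2 \<le> s\<^sup>2 * cmod z" .
    show "2 * cmod z \<le> s\<^sup>2" unfolding s_def using n z by linarith
  qed
  have "z \<noteq> 0" using z by auto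
  have "s\<^sup>2 * cmod z / 2 \<le> cmod (1 + of_real (s\<^sup>2) * z)"
    using norm_triangle_ineq4[of "1 + of_real (s\<^sup>2) * z" 1] s(2)
    by (simp add: norm_mult norm_power)
  then have 1: "cmod (of_real s * z / (1 + of_real (s\<^sup>2) * z)) \<le> 2 * (1 / s)"
  proof -
    assume le: "s\<^sup>2 * cmod z / 2 \<le> cmod (1 + of_real (s\<^sup>2) * z)"
    have pos: "s\<^sup>2 * cmod z / 2 > 0" using s by simp
    have "s * cmod z / cmod (1 + of_real (s\<^sup>2) * z) \<le> s * cmod z / (s\<^sup>2 * cmod z / 2)"
      using le pos s(1) by (intro divide_left_mono mult_pos_pos) auto
    also have "\<dots> = 2 * (1 / s)" using s(1) \<open>z \<noteq> 0\<close> by (simp add: field_simps power2_eq_square)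
    finally show ?thesis using s(1) by (simp only: norm_divide norm_mult norm_of_real abs_of_pos)
  qed
  have "s\<^sup>2 / 2 \<le> cmod (of_real (s\<^sup>2) + z)"
    using norm_triangle_ineq4[of "of_real (s\<^sup>2) + z" z] s(3)
    by (simp add: norm_power)
  then have "cmod (of_real s * z / (of_real (s\<^sup>2) + z)) \<le> (2 * cmod z) * (1 / s)"
  proof -
    assume le: "s\<^sup>2 / 2 \<le> cmod (of_real (s\<^sup>2) + z)"
    have pos: "s\<^sup>2 / 2 > 0" using s(1) by simp
    have "s * cmod z / cmod (of_real (s\<^sup>2) + z) \<le> s * cmod z / (s\<^sup>2 / 2)"
      using le pos s(1) by (intro divide_left_mono mult_pos_pos) auto
    also have "\<dots> = (2 * cmod z) * (1 / s)" using s(1) by (simp add: field_simps power2_eq_square)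
    finally show ?thesis using s(1) by (simp only: norm_divide norm_mult norm_of_real abs_of_pos)
  qed
  also have "\<dots> \<le> (2 * R) * (1 / s)" using s z by (intro mult_right_mono) auto
  finally have "cmod (molnar_cterm d n z) \<le> 2 * (1 / s) + (2 * R) * (1 / s)"
    unfolding molnar_cterm_def s_def[symmetric] using 1 by (intro norm_triangle_le add_mono)
  then show ?thesis unfolding s_def by (simp only: distrib_right)
qed

text \<open>The bound holds only for large n, hence the eventual form of the M-test; for small n a
  denominator may even vanish at a negative point of the annulus. Annuli suit both uses: they
  contain small discs around points of the slit plane and the spectra of invertible positive
  operators.\<close>

lemma molnar_cterm_uniform_limit:
  assumes d: "d > 1" and r: "0 < r"
  shows "uniform_limit {z. r \<le> cmod z \<and> cmod z \<le> R} (\<lambda>n z. \<Sum>i<n. molnar_cterm d i z)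
           (\<lambda>z. \<Sum>i. molnar_cterm d i z) sequentially"
proof (rule Weierstrass_m_test_ev)
  have "\<forall>\<^sub>F n in sequentially. 2 / r \<le> (wt d n)\<^sup>2 \<and> 2 * R \<le> (wt d n)\<^sup>2"
    using wt_at_top[OF d] unfolding filterlim_at_top by (intro eventually_conj) auto
  then show "\<forall>\<^sub>F n in sequentially. \<forall>z\<in>{z. r \<le> cmod z \<and> cmod z \<le> R}.
      cmod (molnar_cterm d n z) \<le> (2 + 2 * R) * (1 / wt d n)"
    by eventually_elim (use molnar_cterm_norm_le[OF d r] in auto)
qed (intro summable_mult summable_inverse_wt d)

lemma summable_molnar_cterm:
  assumes "d > 1" "z \<noteq> 0"
  shows "summable (\<lambda>n. molnar_cterm d n z)"
proof -
  have "(\<lambda>n. \<Sum>i<n. molnar_cterm d i z) \<longlonglongrightarrow> (\<Sum>i. molnar_cterm d i z)"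
    by (rule tendsto_uniform_limitI[OF molnar_cterm_uniform_limit[OF assms(1), of "cmod z" "cmod z"]])
       (use assms in auto)
  then show ?thesis by (auto simp: summable_def sums_def)
qed

lemma molnar_cterm_of_real: "molnar_cterm d n (of_real x) = of_real (molnar_term d n x)"
  by (simp add: molnar_cterm_def molnar_term_def)

lemma molnar_term_pos: "d > 1 \<Longrightarrow> x > 0 \<Longrightarrow> molnar_term d n x > 0"
  unfolding molnar_term_def using wt_pos[of d n]
  by (intro add_pos_pos divide_pos_pos mult_pos_pos zero_less_power) auto

lemma summable_molnar_parts:
  assumes "d > 1" "x > 0"
  shows "summable (\<lambda>n. wt d n * x / (1 + (wt d n)\<^sup>2 * x))" "summable (\<lambda>n. wt d n * x / ((wt d n)\<^sup>2 + x))"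
proof -
  have w: "wt d n > 0" for n using assms(1) by (rule wt_pos)
  show "summable (\<lambda>n. wt d n * x / (1 + (wt d n)\<^sup>2 * x))"
  proof (rule summable_comparison_test'[OF summable_inverse_wt[OF assms(1)]])
    fix n
    have "1 + (wt d n)\<^sup>2 * x > 0" using w[of n] assms by (intro add_pos_pos mult_pos_pos) auto
    then show "norm (wt d n * x / (1 + (wt d n)\<^sup>2 * x)) \<le> 1 / wt d n"
      using w[of n] assms by (simp add: divide_simps) (simp add: power2_eq_square algebra_simps)
  qed
  show "summable (\<lambda>n. wt d n * x / ((wt d n)\<^sup>2 + x))"
  proof (rule summable_comparison_test'[OF summable_mult[OF summable_inverse_wt[OF assms(1)], of x]])
    fix n
    have "(wt d n)\<^sup>2 + x > 0" using w[of n] assms by (intro add_pos_pos) auto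
    then show "norm (wt d n * x / ((wt d n)\<^sup>2 + x)) \<le> x * (1 / wt d n)"
      using w[of n] assms by (simp add: divide_simps) (simp add: power2_eq_square algebra_simps)
  qed
qed

lemma summable_molnar_term: "d > 1 \<Longrightarrow> x > 0 \<Longrightarrow> summable (\<lambda>n. molnar_term d n x)"
  unfolding molnar_term_def by (intro summable_add summable_molnar_parts)

lemma molnar_const_pos: "d > 1 \<Longrightarrow> molnar_const d > 0"
  unfolding molnar_const_def by (intro suminf_pos summable_molnar_term molnar_term_pos) auto

lemma molnar_fun_of_real:
  assumes "d > 1" "x > 0"
  shows "molnar_fun d (of_real x) = of_real ((\<Sum>n. molnar_term d n x) / molnar_const d)"
  unfolding molnar_fun_def molnar_cterm_of_real
  by (simp add: suminf_of_real[OF summable_molnar_term[OF assms]])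

text \<open>Multiplying by the conjugate of the denominator makes the quadratic term real, so the
  imaginary part of the numerator is a times Im z.\<close>

lemma Im_divide_affine_nonneg:
  assumes "a \<ge> 0" "Im z \<ge> 0"
  shows "Im (z / (of_real a + of_real b * z)) \<ge> 0"
  unfolding Im_divide using assms
  by (intro divide_nonneg_nonneg) (simp_all add: algebra_simps)

lemma affine_nonzero:
  assumes "z \<notin> \<real>\<^sub>\<le>\<^sub>0" "a > 0" "b > 0"
  shows "of_real a + of_real b * z \<noteq> (0 :: complex)"
proof
  assume "of_real a + of_real b * z = 0"
  then have "z = of_real (- (a / b))"
    using assms(3) by (simp add: field_simps add_eq_0_iff)
  moreover have "- (a / b) \<le> 0" using assms by simp
  ultimately have "z \<in> \<real>\<^sub>\<le>\<^sub>0" by (metis nonpos_Reals_of_real_iff)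
  with assms(1) show False ..
qed

lemma molnar_fun_OM_plus:
  assumes d: "d > 1"
  shows "molnar_fun d \<in> OM_plus"
proof -
  have w: "wt d n > 0" for n using d by (rule wt_pos)
  have w0: "wt d n \<noteq> 0" for n using w[of n] by simp
  have term_alt: "molnar_cterm d n z = of_real (wt d n) * (z / (of_real 1 + of_real ((wt d n)\<^sup>2) * z))
     + of_real (wt d n) * (z / (of_real ((wt d n)\<^sup>2) + of_real 1 * z))" for n z
    by (simp add: molnar_cterm_def)
  have "(\<lambda>z. \<Sum>n. molnar_cterm d n z) holomorphic_on (- \<real>\<^sub>\<le>\<^sub>0)"
  proof (rule holomorphic_uniform_sequence)
    show "open (- \<real>\<^sub>\<le>\<^sub>0 :: complex set)" by (simp add: open_Compl)
    show "(\<lambda>z. \<Sum>i<n. molnar_cterm d i z) holomorphic_on (- \<real>\<^sub>\<le>\<^sub>0)" for n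
      unfolding term_alt
      by (intro holomorphic_intros affine_nonzero) (auto simp: w0)
    fix z :: complex assume z: "z \<in> - \<real>\<^sub>\<le>\<^sub>0"
    then have "z \<noteq> 0" by auto
    obtain e where e: "e > 0" "cball z e \<subseteq> - \<real>\<^sub>\<le>\<^sub>0"
      using z open_contains_cball[of "- \<real>\<^sub>\<le>\<^sub>0 :: complex set"] by (auto simp: open_Compl)
    \<comment> \<open>Half of |z| keeps the disc inside the annulus between |z| / 2 and 2 |z|, where
      uniform convergence is known.\<close>
    define \<delta> where "\<delta> = min e (cmod z / 2)"
    have \<delta>: "\<delta> > 0" "\<delta> \<le> e" "\<delta> \<le> cmod z / 2" using e \<open>z \<noteq> 0\<close> by (auto simp: \<delta>_def)
    have "cball z \<delta> \<subseteq> {w. cmod z / 2 \<le> cmod w \<and> cmod w \<le> 2 * cmod z}"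
    proof
      fix w assume "w \<in> cball z \<delta>"
      then have "cmod (z - w) \<le> cmod z / 2" using \<delta> by (simp add: dist_norm)
      then show "w \<in> {w. cmod z / 2 \<le> cmod w \<and> cmod w \<le> 2 * cmod z}"
        using norm_triangle_sub[of z w] norm_triangle_sub[of w z] by (auto simp: norm_minus_commute)
    qed
    then have "uniform_limit (cball z \<delta>) (\<lambda>n z. \<Sum>i<n. molnar_cterm d i z) (\<lambda>z. \<Sum>i. molnar_cterm d i z) sequentially"
      using \<open>z \<noteq> 0\<close> by (intro uniform_limit_on_subset[OF molnar_cterm_uniform_limit[OF d, of "cmod z / 2" "2 * cmod z"]]) auto
    moreover have "cball z \<delta> \<subseteq> - \<real>\<^sub>\<le>\<^sub>0" using e \<delta> by (meson order_trans subset_cball)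
    ultimately show "\<exists>\<delta>>0. cball z \<delta> \<subseteq> - \<real>\<^sub>\<le>\<^sub>0 \<and> uniform_limit (cball z \<delta>)
        (\<lambda>n z. \<Sum>i<n. molnar_cterm d i z) (\<lambda>z. \<Sum>i. molnar_cterm d i z) sequentially"
      using \<delta>(1) by blast
  qed
  then have "molnar_fun d holomorphic_on (- \<real>\<^sub>\<le>\<^sub>0)"
    unfolding molnar_fun_def[abs_def] by (intro holomorphic_intros)
  then have "molnar_fun d analytic_on (- \<real>\<^sub>\<le>\<^sub>0)"
    by (simp add: analytic_on_open open_Compl)
  moreover have "molnar_fun d (of_real x) \<in> \<real>\<^sub>\<ge>\<^sub>0" if "x > 0" for x
  proof -
    have "0 \<le> (\<Sum>n. molnar_term d n x)"
      using molnar_term_pos[OF d that] by (intro suminf_nonneg summable_molnar_term d that less_imp_le)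
    then show ?thesis
      using molnar_const_pos[OF d] by (simp only: molnar_fun_of_real[OF d that] nonneg_Reals_of_real_iff) simp
  qed
  moreover have "Im (molnar_fun d z) \<ge> 0" if z: "Im z > 0" for z
  proof -
    have "z \<noteq> 0" using z by auto
    note sum = summable_molnar_cterm[OF d this]
    have Im_scale: "Im (of_real r * u) = r * Im u" for r u by simp
    have "Im (molnar_cterm d n z) \<ge> 0" for n
      unfolding term_alt plus_complex.sel Im_scale using w[of n] z
      by (intro add_nonneg_nonneg mult_nonneg_nonneg Im_divide_affine_nonneg) auto
    then have "0 \<le> (\<Sum>n. Im (molnar_cterm d n z))"
      by (intro suminf_nonneg bounded_linear.summable[OF bounded_linear_Im] sum)
    then have "0 \<le> Im (\<Sum>n. molnar_cterm d n z)"
      by (simp add: bounded_linear.suminf[OF bounded_linear_Im sum])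
    then show ?thesis
      using molnar_const_pos[OF d] by (simp add: molnar_fun_def)
  qed
  ultimately show ?thesis by (auto simp: OM_plus_def)
qed

text \<open>
  Replacing \<open>x\<close> by \<open>d\<^sup>4 x\<close> shifts the first family of summands up and the second one down; the
  summand that leaves the second family enters the first.
\<close>

lemma molnar_term_suminf_scaled:
  assumes d: "d > 1" and x: "x > 0"
  shows "(\<Sum>n. molnar_term d n (d ^ 4 * x)) = d\<^sup>2 * (\<Sum>n. molnar_term d n x)"
proof -
  define a where "a n x = wt d n * x / (1 + (wt d n)\<^sup>2 * x)" for n x
  define b where "b n x = wt d n * x / ((wt d n)\<^sup>2 + x)" for n x
  have x': "d ^ 4 * x > 0" using d x by simp
  have sum: "summable (\<lambda>n. a n y)" "summable (\<lambda>n. b n y)" if "y > 0" for y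
    unfolding a_def b_def using summable_molnar_parts[OF d that] by auto
  have split: "(\<Sum>n. molnar_term d n y) = (\<Sum>n. a n y) + (\<Sum>n. b n y)" if "y > 0" for y
    using suminf_add[OF sum[OF that]] by (simp add: molnar_term_def a_def b_def)
  have wt_Suc: "wt d (Suc n) = d\<^sup>2 * wt d n" for n
    by (simp add: wt_def power2_eq_square)
  have a_shift: "a n (d ^ 4 * x) = d\<^sup>2 * a (Suc n) x" for n
  proof -
    have "wt d n * (d ^ 4 * x) = d\<^sup>2 * (wt d (Suc n) * x)" "(wt d n)\<^sup>2 * (d ^ 4 * x) = (wt d (Suc n))\<^sup>2 * x"
      by (simp_all add: wt_Suc power_mult_distrib flip: power_mult power_add)
    then show ?thesis unfolding a_def by (simp only: times_divide_eq_right)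
  qed
  have b_shift: "b (Suc n) (d ^ 4 * x) = d\<^sup>2 * b n x" for n
  proof -
    have "b (Suc n) (d ^ 4 * x) = (d ^ 4 * (d\<^sup>2 * (wt d n * x))) / (d ^ 4 * ((wt d n)\<^sup>2 + x))"
      by (simp add: b_def wt_Suc power_mult_distrib algebra_simps)
    also have "\<dots> = d\<^sup>2 * (wt d n * x) / ((wt d n)\<^sup>2 + x)"
      by (rule mult_divide_mult_cancel_left) (use d in simp)
    also have "\<dots> = d\<^sup>2 * b n x" by (simp add: b_def)
    finally show ?thesis .
  qed
  have b_0: "b 0 (d ^ 4 * x) = d\<^sup>2 * a 0 x"
  proof -
    have "b 0 (d ^ 4 * x) = (d\<^sup>2 * (d\<^sup>2 * (d * x))) / (d\<^sup>2 * (1 + d\<^sup>2 * x))"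
      by (simp add: b_def wt_def algebra_simps flip: power_add power_Suc)
    also have "\<dots> = d\<^sup>2 * (d * x) / (1 + d\<^sup>2 * x)"
      by (rule mult_divide_mult_cancel_left) (use d in simp)
    also have "\<dots> = d\<^sup>2 * a 0 x" by (simp add: a_def wt_def)
    finally show ?thesis .
  qed
  have "(\<Sum>n. b n (d ^ 4 * x)) = (\<Sum>n. d\<^sup>2 * b n x) + d\<^sup>2 * a 0 x"
    using suminf_split_head[OF sum(2)[OF x']] by (simp only: b_shift b_0)
  moreover have "(\<Sum>n. a n x) = (\<Sum>n. a (Suc n) x) + a 0 x"
    using suminf_split_head[OF sum(1)[OF x]] by simp
  moreover have "(\<Sum>n. d\<^sup>2 * a (Suc n) x) = d\<^sup>2 * (\<Sum>n. a (Suc n) x)" "(\<Sum>n. d\<^sup>2 * b n x) = d\<^sup>2 * (\<Sum>n. b n x)"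
    using sum[OF x] summable_Suc_iff[of "\<lambda>n. a n x"] by (auto intro!: suminf_mult)
  ultimately show ?thesis
    unfolding split[OF x] split[OF x'] a_shift by (simp add: distrib_left)
qed

section \<open>Separation of the functions by their values at 4\<close>

lemma molnar_value_less:
  assumes d: "d > 1"
  shows "(\<Sum>n. molnar_term d n 4) / molnar_const d < 5 / 2"
proof -
  \<comment> \<open>The comparison with the arithmetic mean holds term by term: a summand divided by
    its value at 1 represents a symmetric mean itself. After clearing denominators the gap is 45
    s^3.\<close>
  have "molnar_term d n 4 < 5 / 2 * molnar_term d n 1" for n
  proof -
    define s where "s = wt d n"
    have s: "s > 0" unfolding s_def using d by (rule wt_pos)
    have "s * 4 / (1 + s\<^sup>2 * 4) + s * 4 / (s\<^sup>2 + 4) = 20 * s * (1 + s\<^sup>2) / ((1 + s\<^sup>2 * 4) * (s\<^sup>2 + 4))"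
    proof -
      have "1 + s\<^sup>2 * 4 > 0" "s\<^sup>2 + 4 > 0" by (auto intro: add_pos_nonneg add_nonneg_pos)
      then show ?thesis by (subst add_frac_eq) (auto simp: algebra_simps)
    qed
    also have "\<dots> < 5 * s / (1 + s\<^sup>2)"
    proof -
      have "20 * s * (1 + s\<^sup>2) * (1 + s\<^sup>2) < 5 * s * ((1 + s\<^sup>2 * 4) * (s\<^sup>2 + 4))"
      proof -
        have "5 * s * ((1 + s\<^sup>2 * 4) * (s\<^sup>2 + 4)) - 20 * s * (1 + s\<^sup>2) * (1 + s\<^sup>2) = 45 * s * s\<^sup>2"
          by (simp add: algebra_simps)
        moreover have "45 * s * s\<^sup>2 > 0" using s by simp
        ultimately show ?thesis by linarith
      qed
      moreover have "1 + s\<^sup>2 * 4 > 0" "s\<^sup>2 + 4 > 0" "1 + s\<^sup>2 > 0" by (auto intro: add_pos_nonneg add_nonneg_pos)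
      ultimately show ?thesis by (simp only: pos_divide_less_eq times_divide_eq_left pos_less_divide_eq mult_pos_pos)
    qed
    also have "\<dots> = 5 / 2 * (s * 1 / (1 + s\<^sup>2 * 1) + s * 1 / (s\<^sup>2 + 1))"
      by (simp add: add.commute)
    finally show ?thesis by (simp add: molnar_term_def s_def)
  qed
  then have "0 < (\<Sum>n. 5 / 2 * molnar_term d n 1 - molnar_term d n 4)"
    by (intro suminf_pos summable_diff summable_mult summable_molnar_term d) auto
  also have "\<dots> = (\<Sum>n. 5 / 2 * molnar_term d n 1) - (\<Sum>n. molnar_term d n 4)"
    by (intro suminf_diff[symmetric] summable_mult summable_molnar_term d) auto
  also have "(\<Sum>n. 5 / 2 * molnar_term d n 1) = 5 / 2 * molnar_const d"
    unfolding molnar_const_def by (intro suminf_mult summable_molnar_term d) auto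
  finally show ?thesis using molnar_const_pos[OF d] by (simp add: field_simps)
qed

text \<open>Only the summand n = 0, where the weight is d, is kept in the numerator, and K is at
  most twice the geometric series of the inverse weights. For large d the first summand dominates,
  so little is lost.\<close>

lemma molnar_value_ge:
  assumes d: "d > 1"
  shows "(d\<^sup>2 - 1) / (2 * d) * (d * 4 / (1 + d\<^sup>2 * 4) + d * 4 / (d\<^sup>2 + 4))
    \<le> (\<Sum>n. molnar_term d n 4) / molnar_const d"
proof -
  have "(\<Sum>n\<in>{0}. molnar_term d n 4) \<le> (\<Sum>n. molnar_term d n 4)"
    using molnar_term_pos[OF d, of 4] by (intro sum_le_suminf summable_molnar_term d) (auto simp: less_imp_le)
  then have 1: "d * 4 / (1 + d\<^sup>2 * 4) + d * 4 / (d\<^sup>2 + 4) \<le> (\<Sum>n. molnar_term d n 4)"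
    by (simp add: molnar_term_def wt_def)
  have "molnar_term d n 1 \<le> 2 * (1 / wt d n)" for n
  proof -
    define s where "s = wt d n"
    have s: "s > 0" unfolding s_def using d by (rule wt_pos)
    have "s / (1 + s\<^sup>2) \<le> s / s\<^sup>2"
      using s by (intro divide_left_mono mult_pos_pos add_pos_pos) auto
    also have "\<dots> = 1 / s" by (simp add: power2_eq_square)
    finally have "s / (1 + s\<^sup>2) \<le> 1 / s" .
    then show ?thesis by (simp add: molnar_term_def add.commute flip: s_def)
  qed
  then have "molnar_const d \<le> (\<Sum>n. 2 * (1 / wt d n))"
    unfolding molnar_const_def by (intro suminf_le summable_molnar_term summable_mult summable_inverse_wt d) auto
  also have "\<dots> = 2 * (d / (d\<^sup>2 - 1))"
    using sums_mult[OF inverse_wt_sums[OF d], of 2] by (simp add: sums_iff)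
  finally have "molnar_const d \<le> 2 * (d / (d\<^sup>2 - 1))" .
  moreover have "d\<^sup>2 - 1 > 0" using d by (simp add: one_less_power)
  ultimately have 2: "(d\<^sup>2 - 1) / (2 * d) \<le> 1 / molnar_const d"
    using molnar_const_pos[OF d] d by (simp add: field_simps)
  have "(d\<^sup>2 - 1) / (2 * d) * (d * 4 / (1 + d\<^sup>2 * 4) + d * 4 / (d\<^sup>2 + 4))
      \<le> 1 / molnar_const d * (\<Sum>n. molnar_term d n 4)"
    using 1 2 molnar_const_pos[OF d] d by (intro mult_mono) (auto intro!: add_nonneg_nonneg divide_nonneg_nonneg)
  then show ?thesis by simp
qed

text \<open>A finite set of values would have a maximum, still strictly below 5/2, whereas the lower
  bounds tend to 5/2.\<close>

lemma infinite_molnar_values: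
  "infinite ((\<lambda>d. (\<Sum>n. molnar_term d n 4) / molnar_const d) ` {1<..})" (is "infinite (?F ` _)")
proof
  assume fin: "finite (?F ` {1<..})"
  define M where "M = Max (?F ` {1<..})"
  have "M \<in> ?F ` {1<..}" unfolding M_def by (intro Max_in fin) auto
  then have M: "M < 5 / 2" using molnar_value_less by auto
  have "((\<lambda>d::real. (d\<^sup>2 - 1) / (2 * d) * (d * 4 / (1 + d\<^sup>2 * 4) + d * 4 / (d\<^sup>2 + 4))) \<longlongrightarrow> 5 / 2) at_top"
    by real_asymp
  from order_tendstoD(1)[OF this M] eventually_gt_at_top[of 1]
  have "\<forall>\<^sub>F d in at_top. d > 1 \<and> M < (d\<^sup>2 - 1) / (2 * d) * (d * 4 / (1 + d\<^sup>2 * 4) + d * 4 / (d\<^sup>2 + 4))"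
    by eventually_elim simp
  then obtain d where d: "d > 1" "M < (d\<^sup>2 - 1) / (2 * d) * (d * 4 / (1 + d\<^sup>2 * 4) + d * 4 / (d\<^sup>2 + 4))"
    by (metis (no_types, lifting) eventually_happens' trivial_limit_at_top_linorder)
  have "?F d \<le> M" unfolding M_def using d(1) by (intro Max_ge fin) auto
  with d(2) molnar_value_ge[OF d(1)] show False by linarith
qed

section \<open>The means\<close>

definition molnar_op_term ::
    "real \<Rightarrow> ('h::complex_hilbert_space \<Rightarrow>\<^sub>L 'h) \<Rightarrow> ('h \<Rightarrow>\<^sub>L 'h) \<Rightarrow> nat \<Rightarrow> ('h \<Rightarrow>\<^sub>L 'h)" where
  "molnar_op_term d A B n =
     (1 / wt d n) *\<^sub>R (par_sum A ((wt d n)\<^sup>2 *\<^sub>R B) + par_sum ((wt d n)\<^sup>2 *\<^sub>R A) B)"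

definition molnar_sum ::
    "real \<Rightarrow> ('h::complex_hilbert_space \<Rightarrow>\<^sub>L 'h) \<Rightarrow> ('h \<Rightarrow>\<^sub>L 'h) \<Rightarrow> ('h \<Rightarrow>\<^sub>L 'h)" where
  "molnar_sum d A B = (1 / molnar_const d) *\<^sub>R (\<Sum>n. molnar_op_term d A B n)"

definition molnar_op :: "real \<Rightarrow> 'h::complex_hilbert_space binop" where
  "molnar_op d = (\<lambda>A\<in>pos_ops. \<lambda>B\<in>pos_ops. molnar_sum d A B)"

lemma molnar_op_apply: "A \<in> pos_ops \<Longrightarrow> B \<in> pos_ops \<Longrightarrow> molnar_op d A B = molnar_sum d A B"
  by (simp add: molnar_op_def)

lemma bounded_linear_op_form: "bounded_linear (\<lambda>A. op_form A x)"
  by (rule bounded_linear_intro[of _ "(norm x)\<^sup>2"])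
     (use abs_op_form_le[of _ x] in \<open>auto simp: op_form_simps\<close>)

lemma molnar_op_term_pos_ops:
  "d > 1 \<Longrightarrow> A \<in> pos_ops \<Longrightarrow> B \<in> pos_ops \<Longrightarrow> molnar_op_term d A B n \<in> pos_ops"
  unfolding molnar_op_term_def using wt_pos[of d n] by (intro pos_ops_closed par_sum_pos_ops) auto

text \<open>A parallel sum lies below each of its arguments. Using the unscaled argument each time
  gives a bound free of the weight, so the factor \<open>1 / wt d n\<close> makes the series
  converge in norm.\<close>

lemma norm_molnar_op_term_le:
  assumes "d > 1" "A \<in> pos_ops" "B \<in> pos_ops"
  shows "norm (molnar_op_term d A B n) \<le> (norm A + norm B) * (1 / wt d n)"
proof -
  have "norm (par_sum A ((wt d n)\<^sup>2 *\<^sub>R B) + par_sum ((wt d n)\<^sup>2 *\<^sub>R A) B) \<le> norm A + norm B"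
    using assms by (intro norm_triangle_le add_mono norm_par_sum_le) auto
  then show ?thesis
    using wt_pos[OF assms(1), of n] by (simp add: molnar_op_term_def divide_right_mono)
qed

lemma summable_molnar_op_term:
  assumes "d > 1" "A \<in> pos_ops" "B \<in> pos_ops"
  shows "summable (molnar_op_term d A B)"
  by (rule summable_comparison_test'[OF summable_mult[OF summable_inverse_wt[OF assms(1)]] norm_molnar_op_term_le[OF assms]])

lemma op_form_molnar_sum:
  assumes "d > 1" "A \<in> pos_ops" "B \<in> pos_ops"
  shows "op_form (molnar_sum d A B) x = 1 / molnar_const d * (\<Sum>n. op_form (molnar_op_term d A B n) x)"
    and "summable (\<lambda>n. op_form (molnar_op_term d A B n) x)"
  using bounded_linear.suminf[OF bounded_linear_op_form summable_molnar_op_term[OF assms], of x]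
    bounded_linear.summable[OF bounded_linear_op_form summable_molnar_op_term[OF assms], of x]
  by (simp_all add: molnar_sum_def op_form_simps)

lemma molnar_sum_pos_ops:
  assumes "d > 1" "A \<in> pos_ops" "B \<in> pos_ops"
  shows "molnar_sum d A B \<in> pos_ops"
proof -
  have "(\<Sum>i<n. molnar_op_term d A B i) \<in> pos_ops" for n
    by (induction n) (auto intro: molnar_op_term_pos_ops assms)
  moreover have "(\<lambda>n. (\<Sum>i<n. molnar_op_term d A B i) x) \<longlonglongrightarrow> (\<Sum>n. molnar_op_term d A B n) x" for x
    using blinfun.tendsto[OF summable_LIMSEQ[OF summable_molnar_op_term[OF assms]] tendsto_const] .
  ultimately have "(\<Sum>n. molnar_op_term d A B n) \<in> pos_ops"
    by (rule pos_ops_strong_limit[where X = "\<lambda>n. \<Sum>i<n. molnar_op_term d A B i", rotated])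
  then show ?thesis
    unfolding molnar_sum_def using molnar_const_pos[OF assms(1)] by auto
qed

lemma op_form_molnar_op_term:
  assumes "A \<in> pos_ops" "B \<in> pos_ops"
  shows "op_form (molnar_op_term d A B n) x =
    1 / wt d n * (par_form A ((wt d n)\<^sup>2 *\<^sub>R B) x + par_form ((wt d n)\<^sup>2 *\<^sub>R A) B x)"
  using assms by (simp add: molnar_op_term_def op_form_simps op_form_par_sum)

lemma molnar_sum_mono:
  assumes d: "d > 1" and pos: "A \<in> pos_ops" "B \<in> pos_ops" "C \<in> pos_ops" "D \<in> pos_ops"
    and le: "A \<preceq> C" "B \<preceq> D"
  shows "molnar_sum d A B \<preceq> molnar_sum d C D"
proof -
  have "op_form (molnar_op_term d A B n) x \<le> op_form (molnar_op_term d C D n) x" for n x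
    unfolding op_form_molnar_op_term[OF pos(1,2)] op_form_molnar_op_term[OF pos(3,4)]
    using wt_pos[OF d, of n] loewner_leD[OF le(1)] loewner_leD[OF le(2)]
    by (intro mult_left_mono add_mono par_form_mono) (auto simp: op_form_simps intro: pos mult_left_mono)
  then have "op_form (molnar_sum d A B) x \<le> op_form (molnar_sum d C D) x" for x
    using molnar_const_pos[OF d] d pos op_form_molnar_sum(2)
    by (simp only: op_form_molnar_sum(1)) (intro mult_left_mono suminf_le; force)
  then show ?thesis
    using molnar_sum_pos_ops[OF d pos(1,2)] molnar_sum_pos_ops[OF d pos(3,4)]
    by (simp add: loewner_le_iff pos_ops_symmetric)
qed

lemma conj_scaleR: "C o\<^sub>L (r *\<^sub>R A) o\<^sub>L C = r *\<^sub>R (C o\<^sub>L A o\<^sub>L C)"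
  by (rule blinfun_eqI) (simp add: scaleR_blinfun.rep_eq blinfun.scaleR_right)

lemma molnar_sum_conj_le:
  assumes d: "d > 1" and A: "A \<in> pos_ops" and B: "B \<in> pos_ops" and C: "C \<in> pos_ops"
  shows "C o\<^sub>L molnar_sum d A B o\<^sub>L C \<preceq> molnar_sum d (C o\<^sub>L A o\<^sub>L C) (C o\<^sub>L B o\<^sub>L C)"
proof -
  note sym = pos_ops_symmetric[OF C]
  have conj: "C o\<^sub>L A o\<^sub>L C \<in> pos_ops" "C o\<^sub>L B o\<^sub>L C \<in> pos_ops" using A B sym by (auto intro: pos_ops_conj)
  have "op_form (molnar_op_term d A B n) (C x)
      \<le> op_form (molnar_op_term d (C o\<^sub>L A o\<^sub>L C) (C o\<^sub>L B o\<^sub>L C) n) x" for n x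
  proof -
    have sA: "(wt d n)\<^sup>2 *\<^sub>R A \<in> pos_ops" and sB: "(wt d n)\<^sup>2 *\<^sub>R B \<in> pos_ops" using A B by auto
    show ?thesis
      using par_sum_conj_le[OF A sB sym, of x] par_sum_conj_le[OF sA B sym, of x] wt_pos[OF d, of n]
      unfolding molnar_op_term_def op_form_simps conj_scaleR
      by (intro mult_left_mono add_mono) auto
  qed
  then have "op_form (molnar_sum d A B) (C x) \<le> op_form (molnar_sum d (C o\<^sub>L A o\<^sub>L C) (C o\<^sub>L B o\<^sub>L C)) x" for x
    unfolding op_form_molnar_sum(1)[OF d A B] op_form_molnar_sum(1)[OF d conj]
    using molnar_const_pos[OF d]
    by (intro mult_left_mono suminf_le op_form_molnar_sum(2) d A B conj) auto
  then show ?thesis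
    using molnar_sum_pos_ops[OF d A B] molnar_sum_pos_ops[OF d conj] sym
    by (simp add: loewner_le_iff op_form_conj pos_ops_symmetric op_symmetric_conj)
qed

text \<open>Only forms have to converge. Each summand does by \<open>par_form_tendsto\<close>, and
  limit and series may be exchanged because monotonicity bounds ||X n|| and ||Y n|| by their initial
  values, giving a summable majorant independent of n.\<close>

lemma molnar_sum_decreases:
  fixes A B :: "'h::complex_hilbert_space \<Rightarrow>\<^sub>L 'h"
  assumes d: "d > 1" and pos: "A \<in> pos_ops" "B \<in> pos_ops" "\<And>n. X n \<in> pos_ops" "\<And>n. Y n \<in> pos_ops"
    and lim: "X \<down> A" "Y \<down> B"
  shows "(\<lambda>n. molnar_sum d (X n) (Y n)) \<down> molnar_sum d A B"
proof (rule decreases_toI)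
  show "molnar_sum d (X n) (Y n) \<in> pos_ops" "molnar_sum d A B \<in> pos_ops" for n
    by (intro molnar_sum_pos_ops d pos)+
  have dec: "X (Suc n) \<preceq> X n" "Y (Suc n) \<preceq> Y n" for n
    using lim by (auto simp: decreases_to_def)
  then show "molnar_sum d (X (Suc n)) (Y (Suc n)) \<preceq> molnar_sum d (X n) (Y n)" for n
    by (intro molnar_sum_mono d pos)
  fix x :: 'h
  have norm_le: "norm (X n) \<le> norm (X 0)" "norm (Y n) \<le> norm (Y 0)" for n
    using decreases_to_form(2)[OF lim(1)] decreases_to_form(2)[OF lim(2)]
    by (intro loewner_le_norm pos; simp add: loewner_le_iff pos_ops_symmetric pos decseq_def)+
  let ?M = "\<lambda>k. (norm (X 0) + norm (Y 0)) * (1 / wt d k) * (norm x)\<^sup>2"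
  have "(\<lambda>n. op_form (molnar_op_term d (X n) (Y n) k) x) \<longlonglongrightarrow> op_form (molnar_op_term d A B k) x" for k
    unfolding op_form_molnar_op_term[OF pos(1,2)] op_form_molnar_op_term[OF pos(3,4)]
    by (intro tendsto_mult tendsto_add tendsto_const par_form_tendsto;
        (intro pos pos_ops_closed zero_le_power2)?;
        (unfold op_form_simps)?;
        (intro tendsto_mult tendsto_const mult_left_mono zero_le_power2 decreases_to_form lim)?)
  moreover have "\<forall>\<^sub>F (k, n) in sequentially \<times>\<^sub>F sequentially.
      norm (op_form (molnar_op_term d (X n) (Y n) k) x) \<le> ?M k"
  proof (intro always_eventually allI, clarify)
    fix k n
    have "norm (op_form (molnar_op_term d (X n) (Y n) k) x) \<le> norm (molnar_op_term d (X n) (Y n) k) * (norm x)\<^sup>2"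
      using abs_op_form_le by simp
    also have "\<dots> \<le> (norm (X n) + norm (Y n)) * (1 / wt d k) * (norm x)\<^sup>2"
      by (intro mult_right_mono norm_molnar_op_term_le d pos) simp
    also have "\<dots> \<le> ?M k"
      using wt_pos[OF d, of k] by (intro mult_right_mono add_mono norm_le) auto
    finally show "norm (op_form (molnar_op_term d (X n) (Y n) k) x) \<le> ?M k" .
  qed
  moreover have "summable ?M"
    by (intro summable_mult2 summable_mult summable_inverse_wt d)
  ultimately have "(\<lambda>n. \<Sum>k. op_form (molnar_op_term d (X n) (Y n) k) x)
      \<longlonglongrightarrow> (\<Sum>k. op_form (molnar_op_term d A B k) x)"
    by (intro conjunct2[OF conjunct2[OF tannerys_theorem]]) auto
  then show "(\<lambda>n. op_form (molnar_sum d (X n) (Y n)) x) \<longlonglongrightarrow> op_form (molnar_sum d A B) x"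
    unfolding op_form_molnar_sum(1)[OF d pos(1,2)] op_form_molnar_sum(1)[OF d pos(3,4)]
    by (intro tendsto_mult tendsto_const)
qed

lemma connection_molnar_op:
  assumes d: "d > 1"
  shows "connection (molnar_op d :: 'h::complex_hilbert_space binop)"
  unfolding connection_def
proof (intro conjI ballI allI impI)
  show "(molnar_op d :: 'h binop) \<in> pos_ops \<rightarrow>\<^sub>E pos_ops \<rightarrow>\<^sub>E pos_ops"
    unfolding molnar_op_def by (intro restrict_PiE_iff[THEN iffD2] ballI molnar_sum_pos_ops d)
  fix A B :: "'h \<Rightarrow>\<^sub>L 'h" assume AB: "A \<in> pos_ops" "B \<in> pos_ops"
  show "molnar_op d A B \<preceq> molnar_op d C D" if "C \<in> pos_ops" "D \<in> pos_ops" "A \<preceq> C" "B \<preceq> D" for C D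
    using that AB d by (simp add: molnar_op_apply molnar_sum_mono)
  show "C o\<^sub>L molnar_op d A B o\<^sub>L C \<preceq> molnar_op d (C o\<^sub>L A o\<^sub>L C) (C o\<^sub>L B o\<^sub>L C)" if "C \<in> pos_ops" for C
    using that AB d
    by (simp add: molnar_op_apply molnar_sum_conj_le pos_ops_conj pos_ops_symmetric)
  show "(\<lambda>n. molnar_op d (X n) (Y n)) \<down> molnar_op d A B"
    if "range X \<subseteq> pos_ops" "range Y \<subseteq> pos_ops" "X \<down> A" "Y \<down> B" for X Y
    using that AB d by (simp add: molnar_op_apply molnar_sum_decreases image_subset_iff)
qed

lemma molnar_op_term_commute:
  "A \<in> pos_ops \<Longrightarrow> B \<in> pos_ops \<Longrightarrow> molnar_op_term d A B n = molnar_op_term d B A n"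
  by (simp add: molnar_op_term_def par_sum_commute add.commute)

lemma symmetric_molnar_op: "symmetric_binop (molnar_op d)"
  unfolding symmetric_binop_def
  by (auto simp: molnar_op_apply molnar_sum_def molnar_op_term_commute)

text \<open>At x = 1 this is the normalisation of the mean; at x = 4 it gives the number by which
  different means are told apart.\<close>

lemma molnar_sum_id:
  assumes d: "d > 1" and x: "x > 0"
  shows "molnar_sum d id_blinfun (x *\<^sub>R id_blinfun)
    = ((\<Sum>n. molnar_term d n x) / molnar_const d) *\<^sub>R (id_blinfun :: 'h::complex_hilbert_space \<Rightarrow>\<^sub>L 'h)"
proof -
  have "molnar_op_term d id_blinfun (x *\<^sub>R id_blinfun) n = molnar_term d n x *\<^sub>R (id_blinfun :: 'h \<Rightarrow>\<^sub>L 'h)" for n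
  proof -
    define s where "s = wt d n"
    have s: "s > 0" unfolding s_def using d by (rule wt_pos)
    have "par_sum (1 *\<^sub>R id_blinfun) ((s\<^sup>2 * x) *\<^sub>R id_blinfun) = (1 * (s\<^sup>2 * x) / (1 + s\<^sup>2 * x)) *\<^sub>R (id_blinfun :: 'h \<Rightarrow>\<^sub>L 'h)"
      using s x by (intro par_sum_id_id) auto
    moreover have "par_sum (s\<^sup>2 *\<^sub>R id_blinfun) (x *\<^sub>R id_blinfun) = (s\<^sup>2 * x / (s\<^sup>2 + x)) *\<^sub>R (id_blinfun :: 'h \<Rightarrow>\<^sub>L 'h)"
      using s x by (intro par_sum_id_id) auto
    ultimately have "molnar_op_term d id_blinfun (x *\<^sub>R id_blinfun) n
        = (1 / s * (s\<^sup>2 * x / (1 + s\<^sup>2 * x) + s\<^sup>2 * x / (s\<^sup>2 + x))) *\<^sub>R (id_blinfun :: 'h \<Rightarrow>\<^sub>L 'h)"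
      by (simp add: molnar_op_term_def s_def flip: scaleR_add_left)
    also have "1 / s * (s\<^sup>2 * x / (1 + s\<^sup>2 * x) + s\<^sup>2 * x / (s\<^sup>2 + x)) = molnar_term d n x"
      using s by (simp add: molnar_term_def s_def[symmetric] distrib_left power2_eq_square)
    finally show ?thesis .
  qed
  then have "(\<Sum>n. molnar_op_term d id_blinfun (x *\<^sub>R id_blinfun) n)
      = (\<Sum>n. molnar_term d n x) *\<^sub>R (id_blinfun :: 'h \<Rightarrow>\<^sub>L 'h)"
    using bounded_linear.suminf[OF bounded_linear_scaleR_left[of id_blinfun] summable_molnar_term[OF d x], symmetric]
    by simp
  then show ?thesis by (simp add: molnar_sum_def)
qed

lemma kubo_ando_mean_molnar_op:
  assumes d: "d > 1"
  shows "kubo_ando_mean (molnar_op d :: 'h::complex_hilbert_space binop)"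
proof -
  have "molnar_sum d id_blinfun (1 *\<^sub>R id_blinfun) = (id_blinfun :: 'h \<Rightarrow>\<^sub>L 'h)"
    using molnar_const_pos[OF d] unfolding molnar_sum_id[OF d zero_less_one]
    by (simp flip: molnar_const_def)
  then show ?thesis
    using connection_molnar_op[OF d] by (simp add: kubo_ando_mean_def molnar_op_apply)
qed

section \<open>Identification of the representing function\<close>

lemma fun_calc_rel_molnar_sum:
  fixes C :: "'h::complex_hilbert_space \<Rightarrow>\<^sub>L 'h"
  assumes nontriv: "\<exists>x::'h. x \<noteq> 0" and d: "d > 1" and C: "C \<in> pos_inv_ops"
  shows "fun_calc_rel C (molnar_fun d) (molnar_sum d id_blinfun C)"
proof -
  have pos: "C \<in> pos_ops" using C by (simp add: pos_inv_ops_def)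
  have sym: "op_symmetric C" using pos by (rule pos_ops_symmetric)
  note bdd = op_symmetric_bounded_ops[OF sym]
  obtain r where r: "r > 0" "\<And>x. r * (norm x)\<^sup>2 \<le> op_form C x"
    using pos_inv_ops_coercive[OF C] by blast
  have "op_spectrum C \<subseteq> complex_of_real ` {r..norm C}"
    by (intro op_spectrum_subset sym r op_form_le)
  \<comment> \<open>Invertibility keeps the spectrum away from 0 and the norm bounds it, so it lies
    in an annulus of uniform convergence.\<close>
  then have spec: "op_spectrum C \<subseteq> {z. r \<le> cmod z \<and> cmod z \<le> norm C}"
    using r(1) by force
  have rel: "fun_calc_rel C (molnar_cterm d n) (molnar_op_term d id_blinfun C n)" for n
  proof -
    define s where "s = wt d n"
    have s: "s > 0" unfolding s_def using d by (rule wt_pos)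
    have "fun_calc_rel C (\<lambda>z. of_real (1 / s) * (of_real (1 * s\<^sup>2) * z / (of_real 1 + of_real (s\<^sup>2) * z)
          + of_real (s\<^sup>2 * 1) * z / (of_real (s\<^sup>2) + of_real 1 * z)))
        ((1 / s) *\<^sub>R (par_sum (1 *\<^sub>R id_blinfun) (s\<^sup>2 *\<^sub>R C) + par_sum (s\<^sup>2 *\<^sub>R id_blinfun) (1 *\<^sub>R C)))"
      using s by (intro fun_calc_rel_scale fun_calc_rel_add fun_calc_rel_par_sum sym bdd nontriv C) auto
    moreover have "(\<lambda>z. of_real (1 / s) * (of_real (1 * s\<^sup>2) * z / (of_real 1 + of_real (s\<^sup>2) * z)
          + of_real (s\<^sup>2 * 1) * z / (of_real (s\<^sup>2) + of_real 1 * z))) = molnar_cterm d n"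
      using s by (simp add: fun_eq_iff molnar_cterm_def s_def[symmetric] distrib_left power2_eq_square)
    ultimately show ?thesis by (simp add: molnar_op_term_def s_def)
  qed
  have "fun_calc_rel C (\<lambda>z. \<Sum>n. molnar_cterm d n z) (\<Sum>n. molnar_op_term d id_blinfun C n)"
  proof (rule fun_calc_rel_limit)
    show "fun_calc_rel C (\<lambda>z. \<Sum>i<n. molnar_cterm d i z) (\<Sum>i<n. molnar_op_term d id_blinfun C i)" for n
      by (intro fun_calc_rel_sum bdd rel)
    show "uniform_limit (op_spectrum C) (\<lambda>n z. \<Sum>i<n. molnar_cterm d i z) (\<lambda>z. \<Sum>n. molnar_cterm d n z) sequentially"
      by (rule uniform_limit_on_subset[OF molnar_cterm_uniform_limit[OF d r(1)] spec])
    show "(\<lambda>n. \<Sum>i<n. molnar_op_term d id_blinfun C i) \<longlonglongrightarrow> (\<Sum>n. molnar_op_term d id_blinfun C n)"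
      by (intro summable_LIMSEQ summable_molnar_op_term d pos) simp
  qed
  then show ?thesis
    unfolding molnar_fun_def[abs_def] molnar_sum_def by (rule fun_calc_rel_scale[OF sym])
qed

text \<open>Each parallel sum respects an invertible congruence, and T -> C T C is bounded and
  linear, hence passes through the series.\<close>

lemma molnar_sum_conj_eq:
  assumes d: "d > 1" and A: "A \<in> pos_ops" and B: "B \<in> pos_ops" and C: "op_symmetric C" "op_invertible C"
  shows "molnar_sum d (C o\<^sub>L A o\<^sub>L C) (C o\<^sub>L B o\<^sub>L C) = C o\<^sub>L molnar_sum d A B o\<^sub>L C"
proof -
  have lin: "bounded_linear (\<lambda>T. C o\<^sub>L T o\<^sub>L C)"
    by (rule bounded_linear_compose[OF
        bounded_bilinear.bounded_linear_left[OF bounded_bilinear_blinfun_compose]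
        bounded_bilinear.bounded_linear_right[OF bounded_bilinear_blinfun_compose]])
  have "molnar_op_term d (C o\<^sub>L A o\<^sub>L C) (C o\<^sub>L B o\<^sub>L C) n = C o\<^sub>L molnar_op_term d A B n o\<^sub>L C" for n
  proof -
    have "par_sum (C o\<^sub>L A o\<^sub>L C) ((wt d n)\<^sup>2 *\<^sub>R (C o\<^sub>L B o\<^sub>L C)) = C o\<^sub>L par_sum A ((wt d n)\<^sup>2 *\<^sub>R B) o\<^sub>L C"
      "par_sum ((wt d n)\<^sup>2 *\<^sub>R (C o\<^sub>L A o\<^sub>L C)) (C o\<^sub>L B o\<^sub>L C) = C o\<^sub>L par_sum ((wt d n)\<^sup>2 *\<^sub>R A) B o\<^sub>L C"
      using A B C by (simp_all flip: conj_scaleR add: par_sum_conj_eq)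
    then show ?thesis
      by (simp add: molnar_op_term_def conj_scaleR linear_add[OF bounded_linear.linear[OF lin]])
  qed
  then show ?thesis
    using bounded_linear.suminf[OF lin summable_molnar_op_term[OF d A B]]
    by (simp add: molnar_sum_def conj_scaleR)
qed

text \<open>Congruence with the square root R of A reduces the pair (A, B) to (I, C), where the mean
  is given by the functional calculus of C.\<close>

lemma representing_function_molnar_op:
  assumes nontriv: "\<exists>x::'h::complex_hilbert_space. x \<noteq> 0" and d: "d > 1"
  shows "representing_function (molnar_fun d) (molnar_op d :: 'h binop)"
  unfolding representing_function_def
proof (intro conjI ballI molnar_fun_OM_plus connection_molnar_op d)
  fix A B :: "'h \<Rightarrow>\<^sub>L 'h" assume A: "A \<in> pos_inv_ops" and B: "B \<in> pos_inv_ops"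
  define R where "R = op_sqrt A"
  define C where "C = op_inv R o\<^sub>L B o\<^sub>L op_inv R"
  have R: "R \<in> pos_inv_ops" "R o\<^sub>L R = A"
    unfolding R_def using op_sqrt_pos_inv_ops[OF nontriv A] by auto
  then have R_sym: "op_symmetric R" and R_inv: "op_invertible R"
    by (auto simp: pos_inv_ops_def pos_ops_symmetric)
  have pos: "A \<in> pos_ops" "B \<in> pos_ops" and B_inv: "op_invertible B"
    using A B by (auto simp: pos_inv_ops_def)
  have "C \<in> pos_ops"
    unfolding C_def by (intro pos_ops_conj pos op_symmetric_op_inv R_sym R_inv)
  moreover have "op_invertible (op_inv R)"
    using inverse_of_sym[OF inverse_of_op_inv[OF R_inv] op_symmetric_bounded_ops[OF R_sym]]
    by (auto simp: op_invertible_def)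
  then have "op_invertible C"
    unfolding C_def using B_inv by (intro op_invertible_compose)
  ultimately have C: "C \<in> pos_inv_ops" "C \<in> pos_ops" by (auto simp: pos_inv_ops_def)
  have A_eq: "A = R o\<^sub>L id_blinfun o\<^sub>L R" using R(2) by simp
  have B_eq: "B = R o\<^sub>L C o\<^sub>L R"
    by (rule blinfun_eqI) (simp add: C_def op_inv_simps[OF R_inv])
  have "molnar_sum d A B = R o\<^sub>L molnar_sum d id_blinfun C o\<^sub>L R"
    by (subst A_eq, subst B_eq, rule molnar_sum_conj_eq) (use d C R_sym R_inv in auto)
  moreover have "fun_calc (molnar_fun d) C = molnar_sum d id_blinfun C"
    using fun_calc_rel_molnar_sum[OF nontriv d C(1)] pos_ops_symmetric[OF C(2)]
    by (intro fun_calc_eqI nontriv)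
  ultimately show "molnar_op d A B = op_sqrt A o\<^sub>L fun_calc (molnar_fun d)
      (op_inv (op_sqrt A) o\<^sub>L B o\<^sub>L op_inv (op_sqrt A)) o\<^sub>L op_sqrt A"
    by (simp add: molnar_op_apply pos flip: R_def C_def)
qed

lemma molnar_mean_molnar_op:
  assumes nontriv: "\<exists>x::'h::complex_hilbert_space. x \<noteq> 0" and d: "d > 1"
  shows "molnar_mean (molnar_op d :: 'h binop)"
  unfolding molnar_mean_def
proof (intro conjI exI[of _ "molnar_fun d"] exI[of _ "d\<^sup>2"] allI impI)
  fix x :: real assume x: "x > 0"
  have "(d\<^sup>2)\<^sup>2 * x = d ^ 4 * x" by simp
  moreover have "d ^ 4 * x > 0" using d x by simp
  ultimately show "molnar_fun d (complex_of_real ((d\<^sup>2)\<^sup>2 * x)) = complex_of_real (d\<^sup>2) * molnar_fun d (complex_of_real x)"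
    using d x by (simp only: molnar_fun_of_real molnar_term_suminf_scaled) simp
qed (use d kubo_ando_mean_molnar_op symmetric_molnar_op representing_function_molnar_op[OF nontriv] in
     \<open>auto simp: power2_eq_1_iff\<close>)

theorem theorem6:
  assumes "\<exists>x::'h::complex_hilbert_space. x \<noteq> 0"
  shows "infinite {\<sigma> :: 'h binop. molnar_mean \<sigma>}"
proof
  assume fin: "finite {\<sigma> :: 'h binop. molnar_mean \<sigma>}"
  obtain x :: 'h where x: "x \<noteq> 0" using assms by blast
  \<comment> \<open>This reads f(4) off an operation, since I \<sigma> 4 I = f(4) I and x is
    nonzero. As a function of the operation it maps finitely many means to finitely many
    values.\<close>
  define value_at where "value_at \<sigma> = op_form (\<sigma> id_blinfun (4 *\<^sub>R id_blinfun)) x / (norm x)\<^sup>2" for \<sigma> :: "'h binop"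
  have "value_at (molnar_op d) = (\<Sum>n. molnar_term d n 4) / molnar_const d" if "d > 1" for d
    using x by (simp add: value_at_def molnar_op_apply molnar_sum_id[OF that] op_form_simps)
  then have "(\<lambda>d. (\<Sum>n. molnar_term d n 4) / molnar_const d) ` {1<..} \<subseteq> value_at ` {\<sigma>. molnar_mean \<sigma>}"
    using molnar_mean_molnar_op[OF assms] by (force simp: image_iff)
  with fin show False
    using infinite_molnar_values finite_subset by blast
qed

end
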